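(* Assume $p\le\exp(\gamma n)$ for some $\gamma>0$. There exist some absolute constants $C,c>0$ such that $$\inf_{\hat\Sigma}\sup_{\Sigma\in\mathcal{F}_k(M)}\sup_Q\mathbb{P}_{(\epsilon,\Sigma,Q)}\left\{\|\hat\Sigma-\Sigma\|_{\rm op}^2\ge C\left(\frac{k+\log p}{n}\vee\epsilon^2\right)\right\}\ge c,$$ and $$\inf_{\hat\Sigma}\sup_{\Sigma\in\mathcal{F}_\alpha(M,M_0,M_{\min})}\sup_Q\mathbb{P}_{(\epsilon,\Sigma,Q)}\left\{\|\hat\Sigma-\Sigma\|_{\rm op}^2\ge C\left(\min\left\{n^{-\frac{2\alpha}{2\alpha+1}}+\frac{\log p}{n},\ \frac pn\right\}\vee\epsilon^2\right)\right\}\ge c,$$ for any $\epsilon\in[0,1]$. Here the infima are over all estimators $\hat\Sigma=\hat\Sigma(X_1,\dots,X_n)$ and $Q$ ranges over all probability distributions on $\mathbb{R}^p$.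
   Context: For $\epsilon\in[0,1]$, a covariance matrix $\Sigma\in\mathbb{R}^{p\times p}$ and a probability distribution $Q$ on $\mathbb{R}^p$, $\mathbb{P}_{(\epsilon,\Sigma,Q)}=(1-\epsilon)N(0,\Sigma)+\epsilon Q$; $X_1,\dots,X_n$ are i.i.d. from it, and the same symbol denotes their joint law. Classes: $\mathcal{F}(M)=\{\Sigma=\Sigma^T\in\mathbb{R}^{p\times p}:\Sigma\succeq0,\ s_{\max}(\Sigma)\le M\}$; $\mathcal{F}_k=\{\Sigma=(\sigma_{ij})\succeq0:\ \sigma_{ij}=0\text{ if }|i-j|>k\}$; $\mathcal{F}_k(M)=\mathcal{F}_k\cap\mathcal{F}(M)$; and $$\mathcal{F}_\alpha(M,M_0,M_{\min})=\Big\{\Sigma=(\sigma_{ij})\in\mathcal{F}(M):\ \max_j\sum_{\{i:|i-j|>k\}}|\sigma_{ij}|\le M_0k^{-\alpha}\text{ for all integers }k\ge1,\ s_{\min}(\Sigma)>M_{\min}\Big\},$$ where $s_{\max},s_{\min}$ are the largest and smallest singular values, $\alpha$ is the decay parameter, and $M>0$, $M_0>0$, $0<M_{\min}<M$ are absolute constants that do not scale with $p$ or $n$. $\|\cdot\|_{\rm op}$ is the operator norm; $a\vee b=\max(a,b)$.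
   Formalization: In the first display the bandwidth is restricted to k ≤ p and k ≤ κn for an arbitrary fixed κ > 0, on which C and c may depend; without this the display is false (e.g. k = p = ⌊exp(γn)⌋, where the zero estimator has bounded loss, or p = 1, k = n). *)

theory Defs
  imports "HOL-Probability.Probability" "Jordan_Normal_Form.Char_Poly"
begin

unbundle no vec_syntax
unbundle no inner_syntax

text \<open>
  The dimension p is quantified inside the theorem (the constants must not depend on it), so it is
  not a type. A point of R^p is a function in the carrier of
  \<open>PiM {..<p} (\<lambda>_. borel)\<close>, a p by p matrix is an element of
  \<open>carrier_mat p p\<close>, and all indices run from 0 to p - 1.
\<close>

abbreviation R_space :: "nat \<Rightarrow> (nat \<Rightarrow> real) measure" where
  "R_space p \<equiv> PiM {..<p} (\<lambda>_. borel)"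


section \<open>Matrices\<close>

definition vec_norm :: "real vec \<Rightarrow> real" where
  "vec_norm x = sqrt (x \<bullet> x)"

definition op_norm :: "real mat \<Rightarrow> real" where
  "op_norm A = (SUP x \<in> {x \<in> carrier_vec (dim_col A). vec_norm x \<le> 1}. vec_norm (A *\<^sub>v x))"

definition singular_values :: "real mat \<Rightarrow> real set" where
  "singular_values A = {sqrt l |l. eigenvalue (transpose_mat A * A) l}"

definition s_max :: "real mat \<Rightarrow> real" where
  "s_max A = Max (singular_values A)"

definition s_min :: "real mat \<Rightarrow> real" where
  "s_min A = Min (singular_values A)"

definition psd :: "nat \<Rightarrow> real mat \<Rightarrow> bool" where
  "psd p A \<longleftrightarrow> A \<in> carrier_mat p p \<and> transpose_mat A = A \<and>
     (\<forall>x \<in> carrier_vec p. 0 \<le> x \<bullet> (A *\<^sub>v x))"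

definition psd_sqrt :: "nat \<Rightarrow> real mat \<Rightarrow> real mat" where
  "psd_sqrt p A = (THE B. psd p B \<and> B * B = A)"


section \<open>The contamination model\<close>

text \<open>
  N(0, S) is the law of the image of a standard Gaussian vector under the positive semidefinite
  square root of S. This covers singular S, for which there is no Lebesgue density.
\<close>

definition gaussian :: "nat \<Rightarrow> real mat \<Rightarrow> (nat \<Rightarrow> real) measure" where
  "gaussian p S =
     distr (PiM {..<p} (\<lambda>_. density lborel std_normal_density)) (R_space p)
       (\<lambda>z. \<lambda>i\<in>{..<p}. (psd_sqrt p S *\<^sub>v vec p z) $ i)"

definition prob_distributions :: "nat \<Rightarrow> (nat \<Rightarrow> real) measure set" where
  "prob_distributions p = {Q. prob_space Q \<and> sets Q = sets (R_space p)}"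

definition contaminated ::
  "nat \<Rightarrow> real \<Rightarrow> real mat \<Rightarrow> (nat \<Rightarrow> real) measure \<Rightarrow> (nat \<Rightarrow> real) measure" where
  "contaminated p \<epsilon> S Q = measure_of (space (R_space p)) (sets (R_space p))
     (\<lambda>A. ennreal (1 - \<epsilon>) * emeasure (gaussian p S) A + ennreal \<epsilon> * emeasure Q A)"

definition sample_law ::
  "nat \<Rightarrow> nat \<Rightarrow> real \<Rightarrow> real mat \<Rightarrow> (nat \<Rightarrow> real) measure \<Rightarrow> (nat \<Rightarrow> nat \<Rightarrow> real) measure" where
  "sample_law n p \<epsilon> S Q = PiM {..<n} (\<lambda>_. contaminated p \<epsilon> S Q)"

text \<open>
  \<open>X i\<close> is the i-th observation. The matrix type carries no topology, so
  measurability of an estimator is measurability of its entries.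
\<close>

definition estimators :: "nat \<Rightarrow> nat \<Rightarrow> ((nat \<Rightarrow> nat \<Rightarrow> real) \<Rightarrow> real mat) set" where
  "estimators n p = {T.
     (\<forall>X \<in> space (PiM {..<n} (\<lambda>_. R_space p)). T X \<in> carrier_mat p p) \<and>
     (\<forall>i<p. \<forall>j<p. (\<lambda>X. T X $$ (i, j)) \<in> borel_measurable (PiM {..<n} (\<lambda>_. R_space p)))}"


section \<open>Classes of covariance matrices\<close>

definition F_class :: "nat \<Rightarrow> real \<Rightarrow> real mat set" where
  "F_class p M = {S. psd p S \<and> s_max S \<le> M}"

definition F_banded :: "nat \<Rightarrow> nat \<Rightarrow> real mat set" where
  "F_banded p k = {S. psd p S \<and>
     (\<forall>i<p. \<forall>j<p. \<bar>int i - int j\<bar> > int k \<longrightarrow> S $$ (i, j) = 0)}"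

definition F_bandable :: "nat \<Rightarrow> real \<Rightarrow> real \<Rightarrow> real \<Rightarrow> real \<Rightarrow> real mat set" where
  "F_bandable p \<alpha> M M0 Mmin = {S \<in> F_class p M.
     (\<forall>k::nat. k \<ge> 1 \<longrightarrow>
        (MAX j \<in> {..<p}. \<Sum>i | i < p \<and> \<bar>int i - int j\<bar> > int k. \<bar>S $$ (i, j)\<bar>)
          \<le> M0 * real k powr (- \<alpha>)) \<and>
     s_min S > Mmin}"

end

theory Submission
  imports Defs
begin

text \<open>
  Every estimator is defeated by matrices of one shape: the null matrix \<open>a I\<close> and its rank-one
  spikes \<open>a I + a e v v\<^sup>T\<close> with a unit vector \<open>v\<close>. The two matrices are at operator distance
  \<open>a e\<close>, so no estimate is closer than \<open>a e / 2\<close> to both, and a lower bound at level \<open>(a e)\<^sup>2 / 4\<close> follows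
  as soon as the data cannot tell the null matrix from the spikes.

  For the part of the rate without \<open>\<epsilon>\<close> the contamination \<open>Q\<close> is taken equal to the uncontaminated
  Gaussian law, so that the observations are purely Gaussian. The direction \<open>v\<close> is drawn uniformly from a
  finite family, and the law of the sample under the null is compared with the mixture of the laws under the
  spikes. The change of variables \<open>nn_integral_PiM_lborel_rank_one\<close> provides the likelihood ratio
  of a spike against the null, and \<open>sample_lik_product\<close> computes the inner product of two such
  ratios: it is \<open>(1 - (e \<langle>v, w\<rangle>)\<^sup>2) powr (- n / 2)\<close>. The second moment of the mixture
  ratio is therefore bounded as soon as \<open>exp (n (e \<langle>v, w\<rangle>)\<^sup>2)\<close> has bounded mean over two independent
  directions, and then a Le Cam argument (\<open>mixture_test_lower_bound\<close>) gives an error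
  probability of at least \<open>1/8\<close>. Two families suffice:

    \<^item> the \<open>p\<close> coordinate axes. Distinct axes are orthogonal, equal ones are drawn with probability
      \<open>1/p\<close>, so \<open>n e\<^sup>2\<close> may be as large as \<open>ln p\<close>. The spikes are diagonal matrices and lie in every class.

    \<^item> the vectors with entries \<open>\<plusminus> 1 / sqrt m\<close> on the first \<open>m\<close> coordinates. The inner product of
      two random ones is subgaussian with variance \<open>1/m\<close>, so \<open>n e\<^sup>2\<close> may be a small multiple of \<open>m\<close>.
      The off-diagonal row sums of the spike are at most \<open>a e\<close>, all within bandwidth \<open>m\<close>.

  With \<open>m = k\<close> this gives \<open>(k + ln p) / n\<close> for the banded class. In the bandable class the sign family is
  admissible when \<open>sqrt (m / n) \<le> m powr - \<alpha>\<close>, that is \<open>m \<le> n powr (1 / (2 \<alpha> + 1))\<close>, and the largest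
  such \<open>m \<le> p\<close> gives the second rate. The constants come out independent of \<open>\<alpha>\<close> because the size of the
  spike is tied to \<open>sqrt (m / n)\<close> and not to \<open>m powr - \<alpha>\<close>.

  For the part \<open>\<epsilon>\<^sup>2\<close> a single spike with \<open>e\<close> proportional to \<open>\<epsilon>\<close> is enough. Its likelihood ratio is at least
  \<open>1 / sqrt (1 + e) \<ge> 1 - \<epsilon>\<close>, so the spiked law is itself a contaminated version of the null law, and the
  two matrices can generate exactly the same data (\<open>contaminated_scalar_eq_spike\<close>).
\<close>


section \<open>Lebesgue measure under rank-one perturbations of the identity\<close>

text \<open>
  Measures on a finite product are determined by their values on boxes, and on a box the integral of a
  product of densities factors.
\<close>

lemma PiM_density:
  fixes M :: "'i \<Rightarrow> 'a measure"
  assumes I: "finite I" and M: "\<And>i. sigma_finite_measure (M i)"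
    and f [measurable]: "\<And>i. f i \<in> borel_measurable (M i)"
    and D: "\<And>i. sigma_finite_measure (density (M i) (f i))"
  shows "PiM I (\<lambda>i. density (M i) (f i)) = density (PiM I M) (\<lambda>x. \<Prod>i\<in>I. f i (x i))"
proof -
  interpret M: product_sigma_finite M
    using M by (rule product_sigma_finite.intro)
  interpret D: product_sigma_finite "\<lambda>i. density (M i) (f i)"
    using D by (rule product_sigma_finite.intro)
  show ?thesis
  proof (rule D.PiM_eqI[OF I, symmetric])
    show "sets (density (PiM I M) (\<lambda>x. \<Prod>i\<in>I. f i (x i))) = sets (PiM I (\<lambda>i. density (M i) (f i)))"
      unfolding sets_density by (intro sets_PiM_cong) simp_all
  next
    fix A assume "\<And>i. i \<in> I \<Longrightarrow> A i \<in> sets (density (M i) (f i))"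
    then have A [measurable]: "i \<in> I \<Longrightarrow> A i \<in> sets (M i)" for i by simp
    have "emeasure (density (PiM I M) (\<lambda>x. \<Prod>i\<in>I. f i (x i))) (PiE I A) =
        (\<integral>\<^sup>+x. (\<Prod>i\<in>I. f i (x i)) * indicator (PiE I A) x \<partial>PiM I M)"
      using I A by (intro emeasure_density) (auto intro!: sets_PiM_I_finite)
    also have "\<dots> = (\<integral>\<^sup>+x. (\<Prod>i\<in>I. f i (x i) * indicator (A i) (x i)) \<partial>PiM I M)"
    proof (rule nn_integral_cong)
      fix x assume x: "x \<in> space (PiM I M)"
      have "indicator (PiE I A) x = (\<Prod>i\<in>I. indicator (A i) (x i) :: ennreal)"
      proof (cases "x \<in> PiE I A")
        case False
        then obtain i where "i \<in> I" "x i \<notin> A i" using x by (auto simp: space_PiM PiE_iff)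
        then have "(\<Prod>i\<in>I. indicator (A i) (x i) :: ennreal) = 0"
          using I by (intro prod_zero) (auto intro!: bexI[of _ i])
        then show ?thesis using False by simp
      qed (auto simp: PiE_iff)
      then show "(\<Prod>i\<in>I. f i (x i)) * indicator (PiE I A) x =
          (\<Prod>i\<in>I. f i (x i) * indicator (A i) (x i))"
        by (simp add: prod.distrib)
    qed
    also have "\<dots> = (\<Prod>i\<in>I. \<integral>\<^sup>+x. f i x * indicator (A i) x \<partial>M i)"
      using I A by (intro M.product_nn_integral_prod) auto
    also have "\<dots> = (\<Prod>i\<in>I. emeasure (density (M i) (f i)) (A i))"
      using A by (intro prod.cong refl) (simp add: emeasure_density)
    finally show "emeasure (density (PiM I M) (\<lambda>x. \<Prod>i\<in>I. f i (x i))) (PiE I A) =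
        (\<Prod>i\<in>I. emeasure (density (M i) (f i)) (A i))" .
  qed
qed

text \<open>
  The elementary move of the change of variables: one coordinate is rescaled and translated by a function of
  the others. With the other coordinates held fixed this is an affine substitution on the line.
\<close>

lemma nn_integral_PiM_lborel_affine_coordinate:
  fixes f :: "('i \<Rightarrow> real) \<Rightarrow> ennreal"
  assumes I: "finite I" "i \<in> I" and b: "b \<noteq> 0"
    and f [measurable]: "f \<in> borel_measurable (PiM I (\<lambda>_. lborel))"
    and g: "\<And>x t. g (x(i := t)) = g x"
    and F [measurable]: "(\<lambda>x. f (x(i := b * x i + g x))) \<in> borel_measurable (PiM I (\<lambda>_. lborel))"
  shows "ennreal \<bar>b\<bar> * (\<integral>\<^sup>+x. f (x(i := b * x i + g x)) \<partial>PiM I (\<lambda>_. lborel)) =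
    (\<integral>\<^sup>+x. f x \<partial>PiM I (\<lambda>_. lborel))"
proof -
  interpret product_sigma_finite "\<lambda>_::'i. lborel :: real measure" by unfold_locales
  define J where "J = I - {i}"
  have J: "finite J" "i \<notin> J" "insert i J = I" using I by (auto simp: J_def)
  have meas [measurable]: "(\<lambda>y. h (x(i := y))) \<in> borel_measurable lborel"
    if "x \<in> space (PiM J (\<lambda>_. lborel))" "h \<in> borel_measurable (PiM I (\<lambda>_. lborel))"
    for x and h :: "_ \<Rightarrow> ennreal"
  proof -
    have "(\<lambda>y. x(i := y)) \<in> lborel \<rightarrow>\<^sub>M PiM (insert i J) (\<lambda>_. lborel)"
      using that(1) J by (intro measurable_fun_upd[where J=J]) auto
    from measurable_comp[OF this, of h borel] that(2) show ?thesis
      using J(3) by (simp add: comp_def)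
  qed
  have "(\<integral>\<^sup>+x. f x \<partial>PiM I (\<lambda>_. lborel)) =
      (\<integral>\<^sup>+x. \<integral>\<^sup>+y. f (x(i := y)) \<partial>lborel \<partial>PiM J (\<lambda>_. lborel))"
    using product_nn_integral_insert[OF J(1,2), of f] J(3) by simp
  also have "\<dots> = (\<integral>\<^sup>+x. ennreal \<bar>b\<bar> * (\<integral>\<^sup>+y. f (x(i := g x + b * y)) \<partial>lborel) \<partial>PiM J (\<lambda>_. lborel))"
  proof (intro nn_integral_cong)
    fix x assume x: "x \<in> space (PiM J (\<lambda>_. lborel :: real measure))"
    show "(\<integral>\<^sup>+y. f (x(i := y)) \<partial>lborel) = ennreal \<bar>b\<bar> * (\<integral>\<^sup>+y. f (x(i := g x + b * y)) \<partial>lborel)"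
      using meas[OF x f] b by (intro nn_integral_real_affine) auto
  qed
  also have "\<dots> = (\<integral>\<^sup>+x. \<integral>\<^sup>+y. ennreal \<bar>b\<bar> *
      f ((x(i := y))(i := b * (x(i := y)) i + g (x(i := y)))) \<partial>lborel \<partial>PiM J (\<lambda>_. lborel))"
  proof (intro nn_integral_cong)
    fix x assume x: "x \<in> space (PiM J (\<lambda>_. lborel :: real measure))"
    show "ennreal \<bar>b\<bar> * (\<integral>\<^sup>+y. f (x(i := g x + b * y)) \<partial>lborel) =
        (\<integral>\<^sup>+y. ennreal \<bar>b\<bar> * f ((x(i := y))(i := b * (x(i := y)) i + g (x(i := y)))) \<partial>lborel)"
      using meas[OF x F] by (subst nn_integral_cmult) (auto simp: g add.commute)
  qed
  also have "\<dots> = (\<integral>\<^sup>+x. ennreal \<bar>b\<bar> * f (x(i := b * x i + g x)) \<partial>PiM I (\<lambda>_. lborel))"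
    using product_nn_integral_insert[OF J(1,2), of "\<lambda>x. ennreal \<bar>b\<bar> * f (x(i := b * x i + g x))"] J(3)
    by simp
  finally show ?thesis by (simp add: nn_integral_cmult)
qed

text \<open>
  A shear adds multiples of one fixed coordinate to others, one coordinate at a time, and each of these
  moves is a translation.
\<close>

lemma nn_integral_PiM_lborel_shear:
  fixes f :: "('i \<Rightarrow> real) \<Rightarrow> ennreal"
  assumes I: "finite I" "q \<in> I" and J: "J \<subseteq> I - {q}"
    and f: "f \<in> borel_measurable (PiM I (\<lambda>_. lborel))"
  shows "(\<integral>\<^sup>+x. f (\<lambda>k. if k \<in> J then x k + s k * x q else x k) \<partial>PiM I (\<lambda>_. lborel)) =
    (\<integral>\<^sup>+x. f x \<partial>PiM I (\<lambda>_. lborel))"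
proof -
  have "finite J" using I J by (auto intro: finite_subset)
  then show ?thesis using J f
  proof (induction J arbitrary: f rule: finite_induct)
    case (insert j J)
    note insert.prems(2) [measurable]
    have j: "j \<in> I" "j \<noteq> q" using insert.prems by auto
    define F where "F x = f (x(j := 1 * x j + s j * x q))" for x
    have upd: "(\<lambda>x. x(j := 1 * x j + s j * x q)) \<in> PiM I (\<lambda>_. lborel) \<rightarrow>\<^sub>M PiM I (\<lambda>_. lborel :: real measure)"
      using j I by (intro measurable_fun_upd[where J=I]) auto
    have F [measurable]: "F \<in> borel_measurable (PiM I (\<lambda>_. lborel))"
      unfolding F_def using measurable_comp[OF upd insert.prems(2)] by (simp add: comp_def)
    have "(\<integral>\<^sup>+x. f (\<lambda>k. if k \<in> insert j J then x k + s k * x q else x k) \<partial>PiM I (\<lambda>_. lborel)) =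
       (\<integral>\<^sup>+x. F (\<lambda>k. if k \<in> J then x k + s k * x q else x k) \<partial>PiM I (\<lambda>_. lborel))"
      unfolding F_def using insert.hyps(2) insert.prems j
      by (intro nn_integral_cong arg_cong[of _ _ f]) (auto simp: fun_eq_iff)
    also have "\<dots> = (\<integral>\<^sup>+x. F x \<partial>PiM I (\<lambda>_. lborel))"
      using insert.prems by (intro insert.IH F) auto
    also have "\<dots> = (\<integral>\<^sup>+x. f x \<partial>PiM I (\<lambda>_. lborel))"
      using nn_integral_PiM_lborel_affine_coordinate[OF I(1) j(1), of 1 f "\<lambda>x. s j * x q"]
        insert.prems(2) F j unfolding F_def by simp
    finally show ?case .
  qed simp
qed

text \<open>
  The Jacobian of \<open>I + c v v\<^sup>T\<close> is \<open>1 + c\<close>, its slope in the direction \<open>v\<close>. A shear that moves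
  \<open>v\<close> to a multiple of a coordinate axis \<open>q\<close> conjugates the map to one that changes the coordinate \<open>q\<close>
  only, with slope \<open>1 + c\<close>.
\<close>

lemma nn_integral_PiM_lborel_rank_one:
  fixes f :: "('i \<Rightarrow> real) \<Rightarrow> ennreal" and v :: "'i \<Rightarrow> real"
  assumes I: "finite I" and v: "(\<Sum>i\<in>I. (v i)\<^sup>2) = 1" and c: "c \<ge> 0"
    and f [measurable]: "f \<in> borel_measurable (PiM I (\<lambda>_. lborel))"
  shows "ennreal (1 + c) * (\<integral>\<^sup>+x. f (\<lambda>i\<in>I. x i + c * v i * (\<Sum>j\<in>I. v j * x j)) \<partial>PiM I (\<lambda>_. lborel)) =
    (\<integral>\<^sup>+x. f x \<partial>PiM I (\<lambda>_. lborel))"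
proof -
  obtain q where q: "q \<in> I" "v q \<noteq> 0"
  proof (rule ccontr)
    assume "\<not> thesis"
    then have "\<forall>q\<in>I. v q = 0" using that by blast
    then have "(\<Sum>i\<in>I. (v i)\<^sup>2) = 0" by simp
    then show False using v by simp
  qed
  define J where "J = I - {q}"
  define s where "s i = v i / v q" for i
  \<comment> \<open>\<open>U\<close> is the inverse of the shear, it maps a multiple of the axis \<open>q\<close> to \<open>v\<close>, and \<open>E\<close> is the conjugated
    map. They are related by \<open>R U = U E\<close>.\<close>
  define R where "R x = (\<lambda>i\<in>I. x i + c * v i * (\<Sum>j\<in>I. v j * x j))" for x
  define U where "U x = (\<lambda>k. if k \<in> J then x k + s k * x q else x k)" for x :: "'i \<Rightarrow> real"
  define g where "g x = c * v q * (\<Sum>j\<in>J. v j * x j)" for x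
  define E where "E x = x(q := (1 + c) * x q + g x)" for x
  have fin: "finite J" and I_eq: "I = insert q J" "q \<notin> J" using I q by (auto simp: J_def)
  let ?L = "PiM I (\<lambda>_. lborel :: real measure)"
  have R [measurable]: "R \<in> ?L \<rightarrow>\<^sub>M ?L"
    unfolding R_def using I by measurable
  have U [measurable]: "U \<in> ?L \<rightarrow>\<^sub>M ?L"
  proof (rule measurable_PiM_single')
    fix i assume i: "i \<in> I"
    show "(\<lambda>x. U x i) \<in> ?L \<rightarrow>\<^sub>M lborel"
      unfolding U_def using i q by (cases "i \<in> J") (simp_all, measurable)
  qed (auto simp: U_def J_def space_PiM PiE_iff extensional_def)
  have g [measurable]: "g \<in> borel_measurable ?L"
    unfolding g_def by (intro borel_measurable_times borel_measurable_const borel_measurable_sum) (simp add: I_eq(1))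
  have E [measurable]: "E \<in> ?L \<rightarrow>\<^sub>M ?L"
    unfolding E_def using q(1) I by (intro measurable_fun_upd[where J=I]) auto
  have v': "(v q)\<^sup>2 + (\<Sum>j\<in>J. (v j)\<^sup>2) = 1"
    using v fin I_eq by simp
  have conj: "R (U x) = U (E x)" if x: "x \<in> space ?L" for x
  proof -
    have "(\<Sum>j\<in>I. v j * U x j) = v q * x q + (\<Sum>j\<in>J. v j * (x j + s j * x q))"
      using fin I_eq by (simp add: U_def)
    also have "(\<Sum>j\<in>J. v j * (x j + s j * x q)) = (\<Sum>j\<in>J. v j * x j) + (\<Sum>j\<in>J. (v j)\<^sup>2) * x q / v q"
      by (simp add: s_def sum.distrib algebra_simps sum_distrib_left sum_divide_distrib power2_eq_square)
    also have "(\<Sum>j\<in>J. (v j)\<^sup>2) = 1 - (v q)\<^sup>2" using v' by simp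
    finally have dot: "(\<Sum>j\<in>I. v j * U x j) = (\<Sum>j\<in>J. v j * x j) + x q / v q"
      using q(2) by (simp add: field_simps power2_eq_square)
    show ?thesis
    proof (rule ext)
      fix i
      consider "i \<notin> I" | "i = q" | "i \<in> J" using I_eq by auto
      then show "R (U x) i = U (E x) i"
      proof cases
        case 1
        then have "x i = undefined" using x by (auto simp: space_PiM PiE_iff extensional_def)
        moreover have "i \<noteq> q" "i \<notin> J" using 1 I_eq by auto
        ultimately show ?thesis using 1 by (simp add: R_def U_def E_def)
      next
        case 2
        have "R (U x) q = x q + c * v q * ((\<Sum>j\<in>J. v j * x j) + x q / v q)"
          using q(1) I_eq(2) dot by (simp add: R_def U_def)
        also have "\<dots> = (1 + c) * x q + g x"
          using q(2) by (simp add: g_def field_simps)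
        also have "\<dots> = U (E x) q"
          using I_eq(2) by (simp add: U_def E_def)
        finally show ?thesis using 2 by simp
      next
        case 3
        then have i: "i \<in> I" "i \<noteq> q" using I_eq by auto
        have "R (U x) i = x i + s i * x q + c * v i * ((\<Sum>j\<in>J. v j * x j) + x q / v q)"
          using 3 i dot by (simp add: R_def U_def)
        also have "\<dots> = x i + s i * ((1 + c) * x q + g x)"
          using q(2) by (simp add: g_def s_def field_simps)
        also have "\<dots> = U (E x) i"
          using 3 i by (simp add: U_def E_def)
        finally show ?thesis .
      qed
    qed
  qed
  have shear: "(\<integral>\<^sup>+x. h (U x) \<partial>?L) = (\<integral>\<^sup>+x. h x \<partial>?L)" if "h \<in> borel_measurable ?L" for h :: "_ \<Rightarrow> ennreal"
    unfolding U_def using that q(1) by (intro nn_integral_PiM_lborel_shear I) (auto simp: J_def)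
  have "(\<integral>\<^sup>+x. f (R x) \<partial>?L) = (\<integral>\<^sup>+x. f (R (U x)) \<partial>?L)"
    by (rule shear[symmetric]) measurable
  also have "\<dots> = (\<integral>\<^sup>+x. f (U (E x)) \<partial>?L)"
    by (intro nn_integral_cong) (simp add: conj)
  finally have "ennreal (1 + c) * (\<integral>\<^sup>+x. f (R x) \<partial>?L) = ennreal \<bar>1 + c\<bar> * (\<integral>\<^sup>+x. f (U (E x)) \<partial>?L)"
    using c by simp
  also have "\<dots> = (\<integral>\<^sup>+x. f (U x) \<partial>?L)"
    unfolding E_def
  proof (rule nn_integral_PiM_lborel_affine_coordinate[OF I q(1), where f = "\<lambda>x. f (U x)"])
    show "(\<lambda>x. f (U (x(q := (1 + c) * x q + g x)))) \<in> borel_measurable ?L"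
      unfolding E_def[symmetric] by measurable
    show "g (x(q := t)) = g x" for x t
      unfolding g_def using I_eq(2) by (auto intro!: sum.cong)
  qed (use c in auto)
  also have "\<dots> = (\<integral>\<^sup>+x. f x \<partial>?L)" by (rule shear) measurable
  finally show ?thesis unfolding R_def .
qed


section \<open>Rank-one spikes: square root and singular values\<close>

text \<open>
  The matrix \<open>a I + d v v\<^sup>T\<close>. The size \<open>d\<close> is often written \<open>a e\<close> below, because the law of a spike
  depends on \<open>a\<close> only through a scaling when \<open>e\<close> is fixed.
\<close>

definition spike :: "nat \<Rightarrow> real \<Rightarrow> real \<Rightarrow> (nat \<Rightarrow> real) \<Rightarrow> real mat" where
  "spike p a d v = mat p p (\<lambda>(i, j). (if i = j then a else 0) + d * v i * v j)"

definition unit_direction :: "nat \<Rightarrow> (nat \<Rightarrow> real) \<Rightarrow> bool" where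
  "unit_direction p v \<longleftrightarrow> (\<Sum>i<p. (v i)\<^sup>2) = 1"

lemma spike_carrier [simp]: "spike p a d v \<in> carrier_mat p p"
  by (simp add: spike_def)

lemma spike_dim [simp]: "dim_row (spike p a d v) = p" "dim_col (spike p a d v) = p"
  by (simp_all add: spike_def)

lemma spike_index [simp]:
  "i < p \<Longrightarrow> j < p \<Longrightarrow> spike p a d v $$ (i, j) = (if i = j then a else 0) + d * v i * v j"
  by (simp add: spike_def)

lemma transpose_spike [simp]: "transpose_mat (spike p a d v) = spike p a d v"
  by (rule eq_matI) auto

lemma spike_mult_vec:
  assumes "x \<in> carrier_vec p"
  shows "spike p a d v *\<^sub>v x = vec p (\<lambda>i. a * x $ i + d * v i * (\<Sum>j<p. v j * x $ j))"
proof (rule eq_vecI)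
  fix i assume "i < dim_vec (vec p (\<lambda>i. a * x $ i + d * v i * (\<Sum>j<p. v j * x $ j)))"
  then have i: "i < p" by simp
  have "(spike p a d v *\<^sub>v x) $ i = (\<Sum>j<p. ((if i = j then a else 0) + d * v i * v j) * x $ j)"
    using i assms by (auto simp: scalar_prod_def lessThan_atLeast0 intro!: sum.cong)
  also have "\<dots> = (\<Sum>j<p. if i = j then a * x $ j else 0) + (\<Sum>j<p. d * v i * (v j * x $ j))"
    unfolding sum.distrib[symmetric] by (intro sum.cong refl) (simp add: algebra_simps)
  also have "\<dots> = a * x $ i + d * v i * (\<Sum>j<p. v j * x $ j)"
    using i by (simp add: sum_distrib_left)
  finally show "(spike p a d v *\<^sub>v x) $ i =
      vec p (\<lambda>i. a * x $ i + d * v i * (\<Sum>j<p. v j * x $ j)) $ i"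
    using i by simp
qed (simp add: spike_def)

lemma spike_mult_direction:
  assumes "unit_direction p v"
  shows "spike p a d v *\<^sub>v vec p v = (a + d) \<cdot>\<^sub>v vec p v"
proof -
  have "(\<Sum>j<p. v j * vec p v $ j) = 1"
    using assms by (simp add: unit_direction_def power2_eq_square)
  then show ?thesis
    by (subst spike_mult_vec) (auto intro!: eq_vecI simp: algebra_simps)
qed

lemma spike_quadratic_form:
  assumes "x \<in> carrier_vec p"
  shows "x \<bullet> (spike p a d v *\<^sub>v x) = a * (x \<bullet> x) + d * (\<Sum>j<p. v j * x $ j)\<^sup>2"
proof -
  define s where "s = (\<Sum>j<p. v j * x $ j)"
  have "x \<bullet> (spike p a d v *\<^sub>v x) = (\<Sum>i<p. x $ i * (a * x $ i + d * v i * s))"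
    using assms by (simp add: spike_mult_vec scalar_prod_def lessThan_atLeast0 s_def)
  also have "\<dots> = a * (\<Sum>i<p. x $ i * x $ i) + d * (\<Sum>i<p. v i * x $ i) * s"
    by (simp add: sum_distrib_left sum_distrib_right sum.distrib algebra_simps)
  also have "(\<Sum>i<p. x $ i * x $ i) = x \<bullet> x"
    using assms by (simp add: scalar_prod_def lessThan_atLeast0)
  finally show ?thesis by (simp add: s_def power2_eq_square)
qed

lemma scalar_prod_self: "(x::real vec) \<bullet> x = (\<Sum>i<dim_vec x. (x $ i)\<^sup>2)"
  by (simp add: scalar_prod_def lessThan_atLeast0 power2_eq_square)

lemma scalar_prod_self_nonneg: "0 \<le> (x::real vec) \<bullet> x"
  by (simp add: scalar_prod_self sum_nonneg)

lemma scalar_prod_self_eq_0: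
  assumes "x \<in> carrier_vec p" "(x::real vec) \<bullet> x = 0"
  shows "x = 0\<^sub>v p"
  using assms by (auto simp: scalar_prod_self sum_nonneg_eq_0_iff intro!: eq_vecI)

lemma psd_spike: "0 \<le> a \<Longrightarrow> 0 \<le> d \<Longrightarrow> psd p (spike p a d v)"
  by (auto simp: psd_def spike_quadratic_form scalar_prod_self_nonneg)

lemma spike_mult_spike:
  assumes "unit_direction p v"
  shows "spike p a d v * spike p b e v = spike p (a * b) (a * e + d * b + d * e) v"
proof (rule eq_matI)
  fix i j assume "i < dim_row (spike p (a * b) (a * e + d * b + d * e) v)"
    "j < dim_col (spike p (a * b) (a * e + d * b + d * e) v)"
  then have ij: "i < p" "j < p" by simp_all
  have col: "col (spike p b e v) j = vec p (\<lambda>k. (if k = j then b else 0) + e * v k * v j)"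
    using ij by (auto intro!: eq_vecI)
  have "(spike p a d v * spike p b e v) $$ (i, j) = (spike p a d v *\<^sub>v col (spike p b e v) j) $ i"
    using ij by simp
  also have "\<dots> = a * ((if i = j then b else 0) + e * v i * v j) +
      d * v i * (\<Sum>k<p. v k * ((if k = j then b else 0) + e * v k * v j))"
    using ij by (subst spike_mult_vec) (simp_all add: col)
  also have "(\<Sum>k<p. v k * ((if k = j then b else 0) + e * v k * v j)) =
      (\<Sum>k<p. if k = j then b * v k else 0) + e * v j * (\<Sum>k<p. (v k)\<^sup>2)"
    unfolding sum_distrib_left sum.distrib[symmetric]
    by (intro sum.cong refl) (simp add: algebra_simps power2_eq_square)
  also have "\<dots> = b * v j + e * v j"
    using ij assms by (simp add: unit_direction_def)
  finally show "(spike p a d v * spike p b e v) $$ (i, j) =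
      spike p (a * b) (a * e + d * b + d * e) v $$ (i, j)"
    using ij by (simp add: algebra_simps)
qed simp_all

lemma mat_eq_0I:
  fixes A :: "real mat"
  assumes A: "A \<in> carrier_mat p p" and 0: "\<And>x. x \<in> carrier_vec p \<Longrightarrow> A *\<^sub>v x = 0\<^sub>v p"
  shows "A = 0\<^sub>m p p"
proof (rule eq_matI)
  fix i j assume "i < dim_row (0\<^sub>m p p :: real mat)" "j < dim_col (0\<^sub>m p p :: real mat)"
  then have ij: "i < p" "j < p" by simp_all
  have "A $$ (i, j) = (A *\<^sub>v unit_vec p j) $ i"
    using A ij by (simp add: scalar_prod_right_unit)
  also have "\<dots> = 0" using 0[of "unit_vec p j"] ij by simp
  finally show "A $$ (i, j) = 0\<^sub>m p p $$ (i, j)" using ij by simp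
qed (use A in auto)

text \<open>
  Uniqueness of the positive semidefinite square root, in the case that the candidate \<open>R\<close> is positive
  definite and a polynomial in \<open>A\<close>. A second root \<open>B\<close> commutes with \<open>A = B\<^sup>2\<close>, hence with \<open>R\<close>, so
  \<open>(B + R) (B - R) = 0\<close>. Every \<open>y\<close> in the range of \<open>B - R\<close> then satisfies
  \<open>y \<bullet> B y + y \<bullet> R y = 0\<close>, which forces \<open>y = 0\<close>.
\<close>

lemma psd_sqrt_eqI:
  assumes R: "psd p R" and sq: "R * R = A"
    and pos: "\<And>x. x \<in> carrier_vec p \<Longrightarrow> x \<bullet> (R *\<^sub>v x) \<le> 0 \<Longrightarrow> x = 0\<^sub>v p"
    and poly: "R = \<alpha> \<cdot>\<^sub>m 1\<^sub>m p + \<beta> \<cdot>\<^sub>m A"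
  shows "psd_sqrt p A = R"
  unfolding psd_sqrt_def
proof (rule the_equality)
  show "psd p R \<and> R * R = A" using R sq by simp
next
  fix B assume "psd p B \<and> B * B = A"
  then have B: "psd p B" and BB: "B * B = A" by simp_all
  have Bc [simp]: "B \<in> carrier_mat p p" and Rc [simp]: "R \<in> carrier_mat p p"
    using B R by (simp_all add: psd_def)
  have Ac [simp]: "A \<in> carrier_mat p p" using Bc BB by (metis mult_carrier_mat)
  have BA: "B * A = A * B"
    using BB Bc by (metis assoc_mult_mat)
  have "B * R = \<alpha> \<cdot>\<^sub>m B + \<beta> \<cdot>\<^sub>m (B * A)"
  proof -
    have "B * R = B * (\<alpha> \<cdot>\<^sub>m 1\<^sub>m p) + B * (\<beta> \<cdot>\<^sub>m A)"
      unfolding poly by (rule mult_add_distrib_mat[of B p p _ p]) simp_all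
    then show ?thesis
      by (simp add: mult_smult_distrib[of B p p "1\<^sub>m p" p] mult_smult_distrib[of B p p A p]
          right_mult_one_mat[of _ p])
  qed
  moreover have "R * B = \<alpha> \<cdot>\<^sub>m B + \<beta> \<cdot>\<^sub>m (A * B)"
  proof -
    have "R * B = (\<alpha> \<cdot>\<^sub>m 1\<^sub>m p) * B + (\<beta> \<cdot>\<^sub>m A) * B"
      unfolding poly by (rule add_mult_distrib_mat[of _ p p _ B p]) simp_all
    then show ?thesis
      by (simp add: mult_smult_assoc_mat[of "1\<^sub>m p" p p B p] mult_smult_assoc_mat[of A p p B p]
          left_mult_one_mat[of B p p])
  qed
  ultimately have comm: "B * R = R * B" by (simp add: BA)
  have "B - R = 0\<^sub>m p p"
  proof (rule mat_eq_0I)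
    show "B - R \<in> carrier_mat p p" using Rc by (rule minus_carrier_mat)
  next
    fix x :: "real vec" assume x [simp]: "x \<in> carrier_vec p"
    define y where "y = (B - R) *\<^sub>v x"
    have yc [simp]: "y \<in> carrier_vec p" unfolding y_def
      using Bc Rc x by (intro mult_mat_vec_carrier[of _ p p]) (auto intro: minus_carrier_mat)
    have "B *\<^sub>v y = A *\<^sub>v x - (B * R) *\<^sub>v x"
      unfolding y_def using BB
      by (simp add: minus_mult_distrib_mat_vec[of _ p p] mult_minus_distrib_mat_vec[of _ p p]
          mult_mat_vec_carrier[of _ p p] flip: assoc_mult_mat_vec[of _ p p _ p])
    moreover have "R *\<^sub>v y = (B * R) *\<^sub>v x - A *\<^sub>v x"
      unfolding y_def using sq comm
      by (simp add: minus_mult_distrib_mat_vec[of _ p p] mult_minus_distrib_mat_vec[of _ p p]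
          mult_mat_vec_carrier[of _ p p] flip: assoc_mult_mat_vec[of _ p p _ p])
    moreover have "A *\<^sub>v x \<in> carrier_vec p" "(B * R) *\<^sub>v x \<in> carrier_vec p"
      by (auto intro!: mult_mat_vec_carrier[of _ p p] mult_carrier_mat[of _ p p])
    moreover have "(u - w) + (w - u) = 0\<^sub>v p"
      if "u \<in> carrier_vec p" "w \<in> carrier_vec p" for u w :: "real vec"
      using that by (intro eq_vecI) auto
    ultimately have "B *\<^sub>v y + R *\<^sub>v y = 0\<^sub>v p" by simp
    then have "y \<bullet> (B *\<^sub>v y) + y \<bullet> (R *\<^sub>v y) = 0"
      using scalar_prod_add_distrib[of y p "B *\<^sub>v y" "R *\<^sub>v y"]
      by (simp add: mult_mat_vec_carrier[of _ p p])
    moreover have "0 \<le> y \<bullet> (B *\<^sub>v y)" using B by (simp add: psd_def)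
    ultimately have "y = 0\<^sub>v p" by (intro pos) simp_all
    then show "(B - R) *\<^sub>v x = 0\<^sub>v p" by (simp add: y_def)
  qed
  then have "(B - R) $$ (i, j) = 0" if "i < p" "j < p" for i j using that by simp
  then show "B = R"
    using carrier_matD[OF Bc] carrier_matD[OF Rc] by (intro eq_matI) auto
qed

text \<open>
  The parameter \<open>c\<close> belongs to the root: \<open>sqrt a (I + c v v\<^sup>T)\<close> squares to the spike of relative size
  \<open>(1 + c)\<^sup>2 - 1\<close>.
\<close>

lemma psd_sqrt_spike:
  assumes v: "unit_direction p v" and a: "0 < a" and c: "0 \<le> c"
  shows "psd_sqrt p (spike p a (a * ((1 + c)\<^sup>2 - 1)) v) = spike p (sqrt a) (sqrt a * c) v"
proof -
  define d where "d = a * ((1 + c)\<^sup>2 - 1)"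
  \<comment> \<open>The coefficients that express the root as \<open>\<alpha> I + \<beta> A\<close>. For \<open>c = 0\<close> the division by \<open>d = 0\<close> gives
    \<open>\<beta> = 0\<close>, as it should.\<close>
  define \<beta> where "\<beta> = sqrt a * c / d"
  define \<alpha> where "\<alpha> = sqrt a - \<beta> * a"
  have d: "d = a * c * (2 + c)" by (simp add: d_def power2_eq_square algebra_simps)
  have \<beta>: "\<beta> * d = sqrt a * c"
    using a c by (cases "c = 0") (auto simp: \<beta>_def d)
  have "psd_sqrt p (spike p a d v) = spike p (sqrt a) (sqrt a * c) v"
  proof (rule psd_sqrt_eqI[where \<alpha> = \<alpha> and \<beta> = \<beta>])
    show "psd p (spike p (sqrt a) (sqrt a * c) v)"
      using a c by (intro psd_spike) auto
    have e: "sqrt a * (sqrt a * c) + sqrt a * c * sqrt a + sqrt a * c * (sqrt a * c) = d"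
    proof -
      have "b * (b * c) + b * c * b + b * c * (b * c) = b * b * c * (2 + c)" for b :: real
        by (simp add: algebra_simps)
      then show ?thesis using a by (simp only: d real_sqrt_mult_self abs_of_pos)
    qed
    have "sqrt a * sqrt a = a" using a by simp
    then show "spike p (sqrt a) (sqrt a * c) v * spike p (sqrt a) (sqrt a * c) v = spike p a d v"
      unfolding spike_mult_spike[OF v] e by simp
  next
    fix x :: "real vec"
    assume x: "x \<in> carrier_vec p" "x \<bullet> (spike p (sqrt a) (sqrt a * c) v *\<^sub>v x) \<le> 0"
    have "0 \<le> sqrt a * c * (\<Sum>j<p. v j * x $ j)\<^sup>2" using a c by simp
    then have "sqrt a * (x \<bullet> x) \<le> 0" using x by (simp add: spike_quadratic_form)
    then have "x \<bullet> x \<le> 0" using a by (simp add: mult_le_0_iff)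
    then have "x \<bullet> x = 0" using scalar_prod_self_nonneg[of x] by linarith
    then show "x = 0\<^sub>v p" using x(1) by (rule scalar_prod_self_eq_0[rotated])
  next
    show "spike p (sqrt a) (sqrt a * c) v = \<alpha> \<cdot>\<^sub>m 1\<^sub>m p + \<beta> \<cdot>\<^sub>m spike p a d v"
      using \<beta> by (intro eq_matI) (auto simp: \<alpha>_def algebra_simps)
  qed
  then show ?thesis by (simp add: d_def)
qed

text \<open>
  The eigenvalues are \<open>a + d\<close> in the direction \<open>v\<close> and \<open>a\<close> on its orthogonal complement. The latter is
  absent when \<open>p = 1\<close>, which is why only an inclusion is stated.
\<close>

lemma singular_values_spike:
  fixes a d :: real
  assumes v: "unit_direction p v" and a: "0 < a" and d: "0 \<le> d"
  shows "singular_values (spike p a d v) \<subseteq> {a, a + d}" and "a + d \<in> singular_values (spike p a d v)"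
proof -
  have A: "spike p a d v * spike p a d v = spike p (a\<^sup>2) ((a + d)\<^sup>2 - a\<^sup>2) v"
    using spike_mult_spike[OF v, of a d a d] by (simp add: power2_eq_square algebra_simps)
  have vv: "(\<Sum>j<p. v j * v j) = 1" using v by (simp add: unit_direction_def power2_eq_square)
  show "singular_values (spike p a d v) \<subseteq> {a, a + d}"
  proof
    fix s assume "s \<in> singular_values (spike p a d v)"
    then obtain l where l: "s = sqrt l" "eigenvalue (spike p (a\<^sup>2) ((a + d)\<^sup>2 - a\<^sup>2) v) l"
      by (auto simp: singular_values_def A)
    then obtain x where x: "x \<in> carrier_vec p" "x \<noteq> 0\<^sub>v p"
      "spike p (a\<^sup>2) ((a + d)\<^sup>2 - a\<^sup>2) v *\<^sub>v x = l \<cdot>\<^sub>v x"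
      by (auto simp: eigenvalue_def eigenvector_def)
    define t where "t = (\<Sum>j<p. v j * x $ j)"
    have eq: "a\<^sup>2 * x $ i + ((a + d)\<^sup>2 - a\<^sup>2) * v i * t = l * x $ i" if "i < p" for i
    proof -
      have "(spike p (a\<^sup>2) ((a + d)\<^sup>2 - a\<^sup>2) v *\<^sub>v x) $ i = (l \<cdot>\<^sub>v x) $ i" by (simp add: x(3))
      then show ?thesis using that x(1) by (simp add: spike_mult_vec t_def del: index_mult_mat_vec)
    qed
    have "l = a\<^sup>2 \<or> l = (a + d)\<^sup>2"
    proof (cases "t = 0")
      case True
      obtain i where i: "i < p" "x $ i \<noteq> 0"
        using x(1,2) by (metis carrier_vecD eq_vecI index_zero_vec(1,2))
      then show ?thesis using eq[OF i(1)] True by simp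
    next
      case False
      have "(\<Sum>i<p. v i * (a\<^sup>2 * x $ i + ((a + d)\<^sup>2 - a\<^sup>2) * v i * t)) = (\<Sum>i<p. v i * (l * x $ i))"
        using eq by simp
      also have "(\<Sum>i<p. v i * (l * x $ i)) = l * t"
        by (simp add: t_def sum_distrib_left mult.left_commute)
      also have "(\<Sum>i<p. v i * (a\<^sup>2 * x $ i + ((a + d)\<^sup>2 - a\<^sup>2) * v i * t)) =
          (\<Sum>i<p. a\<^sup>2 * (v i * x $ i) + ((a + d)\<^sup>2 - a\<^sup>2) * t * (v i * v i))"
        by (intro sum.cong refl) (simp add: algebra_simps)
      also have "\<dots> = a\<^sup>2 * t + ((a + d)\<^sup>2 - a\<^sup>2) * t * (\<Sum>i<p. v i * v i)"
        by (simp add: sum.distrib t_def flip: sum_distrib_left)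
      finally have "a\<^sup>2 * t + ((a + d)\<^sup>2 - a\<^sup>2) * t * (\<Sum>i<p. v i * v i) = l * t" .
      then have "((a + d)\<^sup>2 - l) * t = 0" by (simp add: vv algebra_simps)
      then show ?thesis using False by simp
    qed
    then show "s \<in> {a, a + d}" using l a d by auto
  qed
  have "eigenvalue (spike p (a\<^sup>2) ((a + d)\<^sup>2 - a\<^sup>2) v) ((a + d)\<^sup>2)"
    unfolding eigenvalue_def eigenvector_def
  proof (intro exI[of _ "vec p v"] conjI)
    show "vec p v \<noteq> 0\<^sub>v (dim_row (spike p (a\<^sup>2) ((a + d)\<^sup>2 - a\<^sup>2) v))"
    proof
      assume "vec p v = 0\<^sub>v (dim_row (spike p (a\<^sup>2) ((a + d)\<^sup>2 - a\<^sup>2) v))"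
      then have "vec p v $ i = 0\<^sub>v p $ i" if "i < p" for i by simp
      then have "\<forall>i<p. v i = 0" by simp
      then show False using vv by simp
    qed
  qed (simp_all add: spike_mult_direction[OF v])
  then have "sqrt ((a + d)\<^sup>2) \<in> singular_values (spike p a d v)"
    unfolding singular_values_def transpose_spike A by blast
  then show "a + d \<in> singular_values (spike p a d v)" using a d by simp
qed

lemma s_max_spike:
  assumes "unit_direction p v" "0 < a" "0 \<le> d"
  shows "s_max (spike p a d v) = a + d"
  unfolding s_max_def using singular_values_spike[OF assms] assms
  by (intro Max_eqI) (auto intro: finite_subset)

lemma s_min_spike_ge:
  assumes "unit_direction p v" "0 < a" "0 \<le> d"
  shows "a \<le> s_min (spike p a d v)"
proof -
  have "finite (singular_values (spike p a d v))"
    using singular_values_spike(1)[OF assms] by (rule finite_subset) simp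
  then show ?thesis unfolding s_min_def
    using singular_values_spike[OF assms] assms(3) by (subst Min_ge_iff) auto
qed


section \<open>Operator norm: separation and measurability\<close>

lemma vec_norm_eq_L2_set: "vec_norm x = L2_set (($) x) {..<dim_vec x}"
  by (simp add: vec_norm_def scalar_prod_self L2_set_def)

lemma vec_norm_triangle:
  assumes "x \<in> carrier_vec p" "y \<in> carrier_vec p"
  shows "vec_norm (x + y) \<le> vec_norm x + vec_norm y"
  using assms L2_set_triangle_ineq[of "($) x" "($) y" "{..<p}"]
  by (simp add: vec_norm_eq_L2_set L2_set_def)

lemma vec_norm_smult: "vec_norm (c \<cdot>\<^sub>v x) = \<bar>c\<bar> * vec_norm x"
  by (simp add: vec_norm_def real_sqrt_mult)

lemma vec_norm_nonneg: "0 \<le> vec_norm x"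
  by (simp add: vec_norm_eq_L2_set)

lemma abs_component_le_vec_norm: "i < dim_vec x \<Longrightarrow> \<bar>x $ i\<bar> \<le> vec_norm x"
  using member_le_L2_set[of "{..<dim_vec x}" i "\<lambda>i. \<bar>x $ i\<bar>"]
  by (simp add: vec_norm_eq_L2_set L2_set_def)

lemma vec_norm_mult_mat_vec:
  assumes "A \<in> carrier_mat p p" "x \<in> carrier_vec p"
  shows "vec_norm (A *\<^sub>v x) = sqrt (\<Sum>i<p. (\<Sum>j<p. A $$ (i, j) * x $ j)\<^sup>2)"
proof -
  have "(A *\<^sub>v x) $ i = (\<Sum>j<p. A $$ (i, j) * x $ j)" if "i < p" for i
    using assms that by (simp add: scalar_prod_def lessThan_atLeast0)
  then show ?thesis
    using assms by (simp add: vec_norm_def scalar_prod_self del: index_mult_mat_vec)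
qed

lemma bdd_above_op_norm:
  assumes A: "A \<in> carrier_mat p p"
  shows "bdd_above ((\<lambda>x. vec_norm (A *\<^sub>v x)) ` {x \<in> carrier_vec p. vec_norm x \<le> 1})"
proof (rule bdd_aboveI2)
  fix x assume "x \<in> {x \<in> carrier_vec p. vec_norm x \<le> 1}"
  then have x: "x \<in> carrier_vec p" "vec_norm x \<le> 1" by auto
  have "\<bar>\<Sum>j<p. A $$ (i, j) * x $ j\<bar> \<le> (\<Sum>j<p. \<bar>A $$ (i, j)\<bar>)" for i
  proof (rule order_trans[OF sum_abs sum_mono])
    fix j assume "j \<in> {..<p}"
    then have "\<bar>x $ j\<bar> \<le> 1" using abs_component_le_vec_norm[of j x] x by auto
    then show "\<bar>A $$ (i, j) * x $ j\<bar> \<le> \<bar>A $$ (i, j)\<bar>"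
      by (simp add: abs_mult mult_left_le)
  qed
  then have "(\<Sum>j<p. A $$ (i, j) * x $ j)\<^sup>2 \<le> (\<Sum>j<p. \<bar>A $$ (i, j)\<bar>)\<^sup>2" for i
    by (metis abs_le_square_iff abs_of_nonneg abs_ge_zero sum_nonneg)
  then show "vec_norm (A *\<^sub>v x) \<le> sqrt (\<Sum>i<p. (\<Sum>j<p. \<bar>A $$ (i, j)\<bar>)\<^sup>2)"
    unfolding vec_norm_mult_mat_vec[OF A x(1)] by (intro real_sqrt_le_mono sum_mono)
qed

lemma vec_norm_le_op_norm:
  assumes "A \<in> carrier_mat p p" "x \<in> carrier_vec p" "vec_norm x \<le> 1"
  shows "vec_norm (A *\<^sub>v x) \<le> op_norm A"
  unfolding op_norm_def using assms bdd_above_op_norm[OF assms(1)]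
  by (intro cSUP_upper) auto

lemma op_norm_nonneg: "A \<in> carrier_mat p p \<Longrightarrow> 0 \<le> op_norm A"
  using order_trans[OF vec_norm_nonneg vec_norm_le_op_norm[of A p "0\<^sub>v p"]]
  by (simp add: vec_norm_def)

text \<open>
  The two matrices differ by \<open>d v v\<^sup>T\<close>, so it suffices to apply both errors to \<open>v\<close>.
\<close>

lemma spike_separation:
  assumes v: "unit_direction p v" and d: "0 \<le> d" and T: "T \<in> carrier_mat p p"
  shows "d \<le> op_norm (T - spike p a 0 v) + op_norm (T - spike p a d v)"
proof -
  let ?v = "vec p v"
  have norm_v: "vec_norm ?v = 1"
    using v by (simp add: vec_norm_def scalar_prod_self unit_direction_def)
  have carr: "(T - spike p a e v) *\<^sub>v ?v \<in> carrier_vec p" for e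
    using T by (intro mult_mat_vec_carrier[of _ p p]) (auto intro: minus_carrier_mat)
  have eq: "(T - spike p a e v) *\<^sub>v ?v = T *\<^sub>v ?v - (a + e) \<cdot>\<^sub>v ?v" for e
    using T by (simp add: minus_mult_distrib_mat_vec[of _ p p] spike_mult_direction[OF v])
  have Tv: "T *\<^sub>v ?v \<in> carrier_vec p" using T by (intro mult_mat_vec_carrier[of _ p p]) auto
  have "d \<cdot>\<^sub>v ?v = (T - spike p a 0 v) *\<^sub>v ?v + (- 1) \<cdot>\<^sub>v ((T - spike p a d v) *\<^sub>v ?v)"
    unfolding eq using Tv by (intro eq_vecI) (auto simp: algebra_simps simp del: index_mult_mat_vec)
  then have "vec_norm (d \<cdot>\<^sub>v ?v) \<le>
      vec_norm ((T - spike p a 0 v) *\<^sub>v ?v) + vec_norm ((- 1) \<cdot>\<^sub>v ((T - spike p a d v) *\<^sub>v ?v))"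
    using carr by (metis vec_norm_triangle smult_carrier_vec)
  then have "d \<le> vec_norm ((T - spike p a 0 v) *\<^sub>v ?v) + vec_norm ((T - spike p a d v) *\<^sub>v ?v)"
    using d norm_v by (simp add: vec_norm_smult)
  also have "\<dots> \<le> op_norm (T - spike p a 0 v) + op_norm (T - spike p a d v)"
    using T norm_v by (intro add_mono vec_norm_le_op_norm[of _ p]) (auto intro: minus_carrier_mat)
  finally show ?thesis .
qed

text \<open>
  A countable dense family of vectors. The entries are read from a list, and lists of rationals form a
  countable type.
\<close>

definition rat_vec :: "nat \<Rightarrow> rat list \<Rightarrow> real vec" where
  "rat_vec p l = vec p (\<lambda>i. if i < length l then of_rat (l ! i) else 0)"

text \<open>
  Rounding a unit vector to rational entries may lead out of the unit ball. Dividing by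
  \<open>max 1 (vec_norm x)\<close> corrects this: the quotient is continuous in \<open>x\<close>, equals the norm of \<open>A x\<close> on the unit
  ball, and never exceeds the operator norm.
\<close>

lemma op_norm_eq_SUP_rat_vec:
  assumes A: "A \<in> carrier_mat p p"
  defines "h \<equiv> \<lambda>x. vec_norm (A *\<^sub>v x) / max 1 (vec_norm x)"
  shows "op_norm A = (SUP l. h (rat_vec p l))"
    and "bdd_above (range (\<lambda>l. h (rat_vec p l)))"
proof -
  have rc [simp]: "rat_vec p l \<in> carrier_vec p" for l by (simp add: rat_vec_def)
  have le: "h (rat_vec p l) \<le> op_norm A" for l
  proof -
    define b where "b = max 1 (vec_norm (rat_vec p l))"
    have b: "b \<ge> 1" "vec_norm (rat_vec p l) \<le> b" by (simp_all add: b_def)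
    have "A *\<^sub>v ((1 / b) \<cdot>\<^sub>v rat_vec p l) = (1 / b) \<cdot>\<^sub>v (A *\<^sub>v rat_vec p l)"
      using A by (simp add: mult_mat_vec[of _ p p])
    then have "h (rat_vec p l) = vec_norm (A *\<^sub>v ((1 / b) \<cdot>\<^sub>v rat_vec p l))"
      using b by (simp add: h_def b_def[symmetric] vec_norm_smult)
    also have "\<dots> \<le> op_norm A"
      using b A by (intro vec_norm_le_op_norm) (auto simp: vec_norm_smult)
    finally show ?thesis .
  qed
  then show bdd: "bdd_above (range (\<lambda>l. h (rat_vec p l)))"
    by (rule bdd_aboveI2)
  have ge: "vec_norm (A *\<^sub>v x) \<le> (SUP l. h (rat_vec p l))"
    if x: "x \<in> carrier_vec p" "vec_norm x \<le> 1" for x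
  proof -
    \<comment> \<open>The entries of \<open>x\<close> are rounded down to multiples of \<open>1 / (m + 1)\<close>.\<close>
    define r where "r m i = (of_int \<lfloor>real (Suc m) * x $ i\<rfloor> / of_nat (Suc m) :: rat)" for m i
    define y where "y m = rat_vec p (map (r m) [0..<p])" for m
    have yi: "y m $ i = real_of_int \<lfloor>real (Suc m) * x $ i\<rfloor> / real (Suc m)" if "i < p" for m i
      using that by (simp add: y_def rat_vec_def r_def of_rat_divide del: of_nat_Suc)
    have lim: "(\<lambda>m. y m $ i) \<longlonglongrightarrow> x $ i" if "i < p" for i
    proof (rule tendsto_sandwich[OF always_eventually always_eventually])
      show "\<forall>m. x $ i - 1 / real (Suc m) \<le> y m $ i"
      proof
        fix m
        have "real (Suc m) * x $ i - 1 \<le> real_of_int \<lfloor>real (Suc m) * x $ i\<rfloor>" by linarith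
        then have "(real (Suc m) * x $ i - 1) / real (Suc m) \<le> y m $ i"
          unfolding yi[OF that] by (intro divide_right_mono) auto
        then show "x $ i - 1 / real (Suc m) \<le> y m $ i" by (simp add: diff_divide_distrib)
      qed
      show "\<forall>m. y m $ i \<le> x $ i"
      proof
        fix m
        have "real_of_int \<lfloor>real (Suc m) * x $ i\<rfloor> \<le> real (Suc m) * x $ i" by linarith
        then show "y m $ i \<le> x $ i" unfolding yi[OF that] by (simp add: field_simps)
      qed
      show "(\<lambda>m. x $ i - 1 / real (Suc m)) \<longlonglongrightarrow> x $ i"
        using tendsto_diff[OF tendsto_const[of "x $ i"] LIMSEQ_inverse_real_of_nat]
        by (simp add: inverse_eq_divide)
    qed simp
    have yc: "y m \<in> carrier_vec p" for m by (simp add: y_def)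
    have "(\<lambda>m. h (y m)) \<longlonglongrightarrow> h x"
      unfolding h_def vec_norm_mult_mat_vec[OF A yc] vec_norm_mult_mat_vec[OF A x(1)]
      unfolding vec_norm_def scalar_prod_self carrier_vecD[OF yc] carrier_vecD[OF x(1)]
      by (intro tendsto_intros lim) auto
    moreover have "h (y m) \<le> (SUP l. h (rat_vec p l))" for m
      unfolding y_def by (rule cSUP_upper[OF UNIV_I bdd])
    ultimately have "h x \<le> (SUP l. h (rat_vec p l))"
      by (intro LIMSEQ_le_const2) auto
    then show ?thesis using x(2) by (simp add: h_def)
  qed
  show "op_norm A = (SUP l. h (rat_vec p l))"
  proof (rule antisym)
    have "0\<^sub>v p \<in> {x \<in> carrier_vec p. vec_norm x \<le> (1::real)}" by (simp add: vec_norm_def)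
    then have ne: "{x \<in> carrier_vec p. vec_norm x \<le> 1} \<noteq> {}" by blast
    show "op_norm A \<le> (SUP l. h (rat_vec p l))"
      unfolding op_norm_def using A ne ge by (intro cSUP_least) auto
    show "(SUP l. h (rat_vec p l)) \<le> op_norm A"
      using le by (intro cSUP_least) auto
  qed
qed

lemma estimator_carrier:
  "T \<in> estimators n p \<Longrightarrow> X \<in> space (PiM {..<n} (\<lambda>_. R_space p)) \<Longrightarrow> T X \<in> carrier_mat p p"
  by (simp add: estimators_def)

text \<open>
  The events in the theorem must be measurable, since \<open>emeasure\<close> is zero elsewhere. A countable supremum
  of continuous functions of the entries is measurable.
\<close>

lemma measurable_op_norm_error:
  assumes T: "T \<in> estimators n p" and S: "S \<in> carrier_mat p p"
  shows "(\<lambda>X. op_norm (T X - S)) \<in> borel_measurable (PiM {..<n} (\<lambda>_. R_space p))"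
    (is "_ \<in> borel_measurable ?M")
proof -
  define h where "h A x = vec_norm (A *\<^sub>v x) / max 1 (vec_norm x)" for A x
  have carr: "T X - S \<in> carrier_mat p p" if "X \<in> space ?M" for X
    using S by (rule minus_carrier_mat)
  have "(\<lambda>X. h (T X - S) (rat_vec p l)) \<in> borel_measurable ?M" for l
  proof -
    have entry: "(\<lambda>X. T X $$ (i, j)) \<in> borel_measurable ?M" if "i < p" "j < p" for i j
      using T that by (simp add: estimators_def)
    have rc: "rat_vec p l \<in> carrier_vec p" by (simp add: rat_vec_def)
    have "(\<lambda>X. sqrt (\<Sum>i<p. (\<Sum>j<p. (T X $$ (i, j) - S $$ (i, j)) * rat_vec p l $ j)\<^sup>2) /
        max 1 (vec_norm (rat_vec p l))) \<in> borel_measurable ?M"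
      by (intro borel_measurable_divide measurable_compose[OF _ borel_measurable_sqrt] borel_measurable_sum
          borel_measurable_power borel_measurable_times borel_measurable_diff
          borel_measurable_const) (auto intro: entry)
    also have "?this \<longleftrightarrow> ?thesis"
      using S by (intro measurable_cong) (simp add: h_def vec_norm_mult_mat_vec[OF carr rc])
    finally show ?thesis .
  qed
  then have "(\<lambda>X. SUP l. h (T X - S) (rat_vec p l)) \<in> borel_measurable ?M"
    using op_norm_eq_SUP_rat_vec(2)[OF carr]
    by (intro borel_measurable_cSUP) (auto simp: h_def)
  also have "?this \<longleftrightarrow> ?thesis"
    using op_norm_eq_SUP_rat_vec(1)[OF carr] by (intro measurable_cong) (simp add: h_def)
  finally show ?thesis .
qed


section \<open>The likelihood ratio of a spike\<close>

abbreviation std_gauss :: "nat \<Rightarrow> (nat \<Rightarrow> real) measure" where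
  "std_gauss p \<equiv> PiM {..<p} (\<lambda>_. density lborel std_normal_density)"

definition rank_one_map :: "nat \<Rightarrow> real \<Rightarrow> (nat \<Rightarrow> real) \<Rightarrow> (nat \<Rightarrow> real) \<Rightarrow> nat \<Rightarrow> real" where
  "rank_one_map p c v x = (\<lambda>i\<in>{..<p}. x i + c * v i * (\<Sum>j<p. v j * x j))"

text \<open>
  The density of \<open>N(0, a I + a e v v\<^sup>T)\<close> with respect to \<open>N(0, a I)\<close>.
\<close>

definition spike_lik :: "nat \<Rightarrow> real \<Rightarrow> real \<Rightarrow> (nat \<Rightarrow> real) \<Rightarrow> (nat \<Rightarrow> real) \<Rightarrow> real" where
  "spike_lik p a e v x = exp (e / (1 + e) * (\<Sum>j<p. v j * x j)\<^sup>2 / (2 * a)) / sqrt (1 + e)"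

lemma measurable_spike_lik [measurable]: "spike_lik p a e v \<in> borel_measurable (R_space p)"
  unfolding spike_lik_def[abs_def] by measurable

lemma sets_std_gauss [measurable_cong, simp]: "sets (std_gauss p) = sets (R_space p)"
  by (intro sets_PiM_cong) simp_all

lemma sets_PiM_lborel [measurable_cong]: "sets (PiM I (\<lambda>_. lborel)) = sets (PiM I (\<lambda>_. borel :: real measure))"
  by (intro sets_PiM_cong) simp_all

lemma std_gauss_eq_density:
  "std_gauss p = density (PiM {..<p} (\<lambda>_. lborel)) (\<lambda>x. ennreal (\<Prod>i<p. std_normal_density (x i)))"
proof -
  interpret N: prob_space "density lborel std_normal_density"
    by (rule prob_space_normal_density) simp
  have "std_gauss p = density (PiM {..<p} (\<lambda>_. lborel)) (\<lambda>x. \<Prod>i<p. ennreal (std_normal_density (x i)))"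
    by (rule PiM_density) (auto intro: N.sigma_finite_measure lborel.sigma_finite_measure_axioms)
  then show ?thesis by (simp add: prod_ennreal)
qed

lemma prod_std_normal_density:
  "(\<Prod>i<p. std_normal_density (x i)) = (1 / sqrt (2 * pi)) ^ p * exp (- (\<Sum>i<p. (x i)\<^sup>2) / 2)"
  by (simp only: std_normal_density_def prod.distrib prod_constant card_lessThan
      exp_sum[OF finite_lessThan, symmetric] sum_negf sum_divide_distrib[symmetric])

lemma measurable_rank_one_map [measurable]: "rank_one_map p c v \<in> R_space p \<rightarrow>\<^sub>M R_space p"
  unfolding rank_one_map_def[abs_def] by measurable

lemma prob_space_std_gauss: "prob_space (std_gauss p)"
  by (intro prob_space_PiM prob_space_normal_density) simp

lemma
  assumes v: "unit_direction p v"
  shows dot_rank_one_map: "(\<Sum>j<p. v j * rank_one_map p c v x j) = (1 + c) * (\<Sum>j<p. v j * x j)"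
    and norm_rank_one_map: "(\<Sum>j<p. (rank_one_map p c v x j)\<^sup>2) =
      (\<Sum>j<p. (x j)\<^sup>2) + ((1 + c)\<^sup>2 - 1) * (\<Sum>j<p. v j * x j)\<^sup>2"
proof -
  define s where "s = (\<Sum>j<p. v j * x j)"
  have v1: "(\<Sum>j<p. (v j)\<^sup>2) = 1" using v by (simp add: unit_direction_def)
  have "(\<Sum>j<p. v j * rank_one_map p c v x j) = (\<Sum>j<p. v j * x j + c * s * (v j)\<^sup>2)"
    by (intro sum.cong) (simp_all add: rank_one_map_def s_def algebra_simps power2_eq_square)
  also have "\<dots> = s + c * s * (\<Sum>j<p. (v j)\<^sup>2)"
    by (simp add: sum.distrib sum_distrib_left s_def)
  finally show "(\<Sum>j<p. v j * rank_one_map p c v x j) = (1 + c) * (\<Sum>j<p. v j * x j)"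
    by (simp add: v1 s_def algebra_simps)
  have "(\<Sum>j<p. (rank_one_map p c v x j)\<^sup>2) =
      (\<Sum>j<p. (x j)\<^sup>2 + 2 * c * s * (v j * x j) + c\<^sup>2 * s\<^sup>2 * (v j)\<^sup>2)"
    by (intro sum.cong) (simp_all add: rank_one_map_def s_def[symmetric] algebra_simps power2_eq_square)
  also have "\<dots> = (\<Sum>j<p. (x j)\<^sup>2) + 2 * c * s * s + c\<^sup>2 * s\<^sup>2 * (\<Sum>j<p. (v j)\<^sup>2)"
    by (simp add: sum.distrib sum_distrib_left s_def)
  finally show "(\<Sum>j<p. (rank_one_map p c v x j)\<^sup>2) =
      (\<Sum>j<p. (x j)\<^sup>2) + ((1 + c)\<^sup>2 - 1) * (\<Sum>j<p. v j * x j)\<^sup>2"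
    unfolding v1 s_def[symmetric] by (simp add: algebra_simps power2_eq_square)
qed

text \<open>
  With \<open>R = I + c v v\<^sup>T\<close> the Gaussian density at \<open>x\<close> equals the Jacobian \<open>1 + c\<close> times the likelihood
  ratio and the Gaussian density at \<open>R x\<close>, because \<open>R\<close> lengthens \<open>x\<close> only along \<open>v\<close>.
\<close>

lemma distr_rank_one_map_std_gauss:
  assumes v: "unit_direction p v" and c: "0 \<le> c"
  shows "distr (std_gauss p) (R_space p) (rank_one_map p c v) =
    density (std_gauss p) (spike_lik p 1 ((1 + c)\<^sup>2 - 1) v)"
proof (rule measure_eqI)
  let ?L = "PiM {..<p} (\<lambda>_. lborel :: real measure)"
  let ?\<phi> = "\<lambda>x. \<Prod>i<p. std_normal_density (x i)"
  let ?\<Lambda> = "spike_lik p 1 ((1 + c)\<^sup>2 - 1) v"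
  let ?R = "rank_one_map p c v"
  have phi [measurable]: "?\<phi> \<in> borel_measurable (R_space p)" by measurable
  have pos: "0 \<le> ?\<phi> x" "0 \<le> ?\<Lambda> x" for x by (auto intro!: prod_nonneg simp: spike_lik_def)
  \<comment> \<open>The factor \<open>exp B\<close> of the likelihood ratio at \<open>R x\<close> cancels the extra length of \<open>R x\<close> along \<open>v\<close>.\<close>
  have key: "?\<phi> x = (1 + c) * (?\<Lambda> (?R x) * ?\<phi> (?R x))" for x
  proof -
    define B where "B = ((1 + c)\<^sup>2 - 1) * (\<Sum>j<p. v j * x j)\<^sup>2 / 2"
    have L: "?\<Lambda> (?R x) = exp B / (1 + c)"
      using c unfolding spike_lik_def dot_rank_one_map[OF v] by (simp add: B_def power_mult_distrib)
    have "- (\<Sum>i<p. (?R x i)\<^sup>2) / 2 = - (\<Sum>i<p. (x i)\<^sup>2) / 2 + - B"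
      unfolding norm_rank_one_map[OF v] by (simp add: B_def add_divide_distrib)
    then have "?\<phi> (?R x) = ?\<phi> x * exp (- B)"
      unfolding prod_std_normal_density by (simp only: exp_add mult.assoc)
    then show ?thesis using c by (simp add: L exp_minus)
  qed
  show "sets (distr (std_gauss p) (R_space p) ?R) = sets (density (std_gauss p) ?\<Lambda>)" by simp
  fix A assume "A \<in> sets (distr (std_gauss p) (R_space p) ?R)"
  then have A [measurable]: "A \<in> sets (R_space p)" by simp
  have "emeasure (distr (std_gauss p) (R_space p) ?R) A =
      (\<integral>\<^sup>+x. indicator A (?R x) \<partial>std_gauss p)"
    by (subst nn_integral_distr[of ?R "std_gauss p" "R_space p" "indicator A", symmetric]) simp_all
  also have "\<dots> = (\<integral>\<^sup>+x. ennreal (?\<phi> x) * indicator A (?R x) \<partial>?L)"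
    unfolding std_gauss_eq_density by (rule nn_integral_density) measurable
  also have "\<dots> = (\<integral>\<^sup>+x. ennreal (1 + c) *
      (ennreal (?\<Lambda> (?R x) * ?\<phi> (?R x)) * indicator A (?R x)) \<partial>?L)"
    using c pos by (intro nn_integral_cong, subst key) (simp add: ennreal_mult mult.assoc)
  also have "\<dots> = ennreal (1 + c) *
      (\<integral>\<^sup>+x. ennreal (?\<Lambda> (?R x) * ?\<phi> (?R x)) * indicator A (?R x) \<partial>?L)"
    by (rule nn_integral_cmult) measurable
  also have "\<dots> = (\<integral>\<^sup>+x. ennreal (?\<Lambda> x * ?\<phi> x) * indicator A x \<partial>?L)"
    using nn_integral_PiM_lborel_rank_one[of "{..<p}" v c
        "\<lambda>x. ennreal (?\<Lambda> x * ?\<phi> x) * indicator A x"] v c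
    by (simp add: unit_direction_def rank_one_map_def[abs_def])
  also have "\<dots> = (\<integral>\<^sup>+x. ennreal (?\<phi> x) * (ennreal (?\<Lambda> x) * indicator A x) \<partial>?L)"
    using pos by (intro nn_integral_cong) (simp add: ennreal_mult ac_simps)
  also have "\<dots> = (\<integral>\<^sup>+x. ennreal (?\<Lambda> x) * indicator A x \<partial>std_gauss p)"
    unfolding std_gauss_eq_density by (rule nn_integral_density[symmetric]) measurable
  also have "\<dots> = emeasure (density (std_gauss p) ?\<Lambda>) A"
    by (rule emeasure_density[symmetric]) measurable
  finally show "emeasure (distr (std_gauss p) (R_space p) ?R) A =
      emeasure (density (std_gauss p) ?\<Lambda>) A" .
qed

definition scaling :: "nat \<Rightarrow> real \<Rightarrow> (nat \<Rightarrow> real) \<Rightarrow> nat \<Rightarrow> real" where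
  "scaling p b x = (\<lambda>i\<in>{..<p}. b * x i)"

lemma measurable_scaling [measurable]: "scaling p b \<in> R_space p \<rightarrow>\<^sub>M R_space p"
  unfolding scaling_def[abs_def] by measurable

lemma spike_lik_scaling:
  assumes "0 < a"
  shows "spike_lik p a e v (scaling p (sqrt a) x) = spike_lik p 1 e v x"
proof -
  have "(\<Sum>j<p. v j * scaling p (sqrt a) x j) = sqrt a * (\<Sum>j<p. v j * x j)"
    unfolding sum_distrib_left by (intro sum.cong) (simp_all add: scaling_def)
  then show ?thesis
    using assms by (simp add: spike_lik_def power_mult_distrib)
qed

lemma gaussian_spike_eq_distr:
  assumes v: "unit_direction p v" and a: "0 < a" and c: "0 \<le> c"
  shows "gaussian p (spike p a (a * ((1 + c)\<^sup>2 - 1)) v) =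
    distr (std_gauss p) (R_space p) (\<lambda>x. scaling p (sqrt a) (rank_one_map p c v x))"
  unfolding gaussian_def psd_sqrt_spike[OF assms]
  by (intro distr_cong refl)
     (auto simp: spike_mult_vec scaling_def rank_one_map_def algebra_simps simp del: index_mult_mat_vec
       intro!: restrict_ext)

lemma spike_0 [simp]: "spike p a 0 v = a \<cdot>\<^sub>m 1\<^sub>m p"
  by (rule eq_matI) auto

definition axis_direction :: "nat \<Rightarrow> nat \<Rightarrow> real" where
  "axis_direction j i = (if i = j then 1 else 0)"

lemma sum_axis_direction: "j < p \<Longrightarrow> (\<Sum>i<p. axis_direction j i * f i) = f j"
  by (simp add: axis_direction_def if_distrib[of "\<lambda>x. x * _"] cong: if_cong)

lemma unit_axis_direction: "j < p \<Longrightarrow> unit_direction p (axis_direction j)"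
  using sum_axis_direction[of j p "axis_direction j"]
  by (simp add: unit_direction_def power2_eq_square) (simp add: axis_direction_def)

text \<open>
  The null matrix is the spike of size \<open>0\<close>, so its law is a special case of the law of a spike.
\<close>

lemma gaussian_scalar:
  assumes p: "1 \<le> p" and a: "0 < a"
  shows "gaussian p (a \<cdot>\<^sub>m 1\<^sub>m p) = distr (std_gauss p) (R_space p) (scaling p (sqrt a))"
proof -
  have "unit_direction p (axis_direction 0)" using p by (intro unit_axis_direction) simp
  from gaussian_spike_eq_distr[OF this a, of 0] show ?thesis
    by (simp add: rank_one_map_def scaling_def[abs_def] cong: restrict_cong)
qed

lemma gaussian_spike_eq_density:
  assumes v: "unit_direction p v" and p: "1 \<le> p" and a: "0 < a" and e: "0 \<le> e"
  shows "gaussian p (spike p a (a * e) v) =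
    density (gaussian p (a \<cdot>\<^sub>m 1\<^sub>m p)) (spike_lik p a e v)"
proof -
  define c where "c = sqrt (1 + e) - 1"
  have c: "0 \<le> c" "(1 + c)\<^sup>2 - 1 = e" using e by (simp_all add: c_def)
  have "gaussian p (spike p a (a * e) v) =
      distr (std_gauss p) (R_space p) (\<lambda>x. scaling p (sqrt a) (rank_one_map p c v x))"
    using gaussian_spike_eq_distr[OF v a c(1)] c(2) by simp
  also have "\<dots> = distr (distr (std_gauss p) (R_space p) (rank_one_map p c v)) (R_space p) (scaling p (sqrt a))"
    by (subst distr_distr) (simp_all add: comp_def)
  also have "\<dots> = distr (density (std_gauss p) (spike_lik p 1 e v)) (R_space p) (scaling p (sqrt a))"
    by (simp add: distr_rank_one_map_std_gauss[OF v c(1)] c(2))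
  also have "spike_lik p 1 e v = (\<lambda>x. spike_lik p a e v (scaling p (sqrt a) x))"
    by (simp add: spike_lik_scaling[OF a])
  also have "distr (density (std_gauss p) (\<lambda>x. spike_lik p a e v (scaling p (sqrt a) x))) (R_space p)
      (scaling p (sqrt a)) =
      density (distr (std_gauss p) (R_space p) (scaling p (sqrt a))) (spike_lik p a e v)"
    by (rule density_distr[symmetric]) measurable
  also have "distr (std_gauss p) (R_space p) (scaling p (sqrt a)) = gaussian p (a \<cdot>\<^sub>m 1\<^sub>m p)"
    using gaussian_scalar[OF p a] by simp
  finally show ?thesis .
qed


section \<open>Inner products of likelihood ratios\<close>

text \<open>
  Completing the square turns the integrand into a multiple of a normal density with variance
  \<open>1 / (1 - q)\<close>.
\<close>

lemma nn_integral_std_normal_exp_quadratic: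
  assumes q: "q < 1"
  shows "(\<integral>\<^sup>+x. ennreal (exp (b * x + q * x\<^sup>2 / 2)) \<partial>density lborel std_normal_density) =
    ennreal (exp (b\<^sup>2 / (2 * (1 - q))) / sqrt (1 - q))"
proof -
  define \<sigma> where "\<sigma> = 1 / sqrt (1 - q)"
  have \<sigma>: "0 < \<sigma>" "\<sigma>\<^sup>2 = 1 / (1 - q)" using q by (simp_all add: \<sigma>_def power_divide)
  have "(\<integral>\<^sup>+x. ennreal (exp (b * x + q * x\<^sup>2 / 2)) \<partial>density lborel std_normal_density) =
      (\<integral>\<^sup>+x. ennreal (std_normal_density x) * ennreal (exp (b * x + q * x\<^sup>2 / 2)) \<partial>lborel)"
    by (rule nn_integral_density) simp_all
  also have "\<dots> = (\<integral>\<^sup>+x. ennreal (exp (b\<^sup>2 / (2 * (1 - q))) / sqrt (1 - q)) *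
      ennreal (normal_density (b / (1 - q)) \<sigma> x) \<partial>lborel)"
  proof (rule nn_integral_cong)
    fix x
    have "- x\<^sup>2 / 2 + (b * x + (1 - r) * x\<^sup>2 / 2) = b\<^sup>2 / (2 * r) + - (x - b / r)\<^sup>2 / (2 * (1 / r))"
      if "0 < r" for r :: real
      using that by (simp add: field_simps power2_eq_square)
    from this[of "1 - q"] q
    have e: "- x\<^sup>2 / 2 + (b * x + q * x\<^sup>2 / 2) =
        b\<^sup>2 / (2 * (1 - q)) + - (x - b / (1 - q))\<^sup>2 / (2 * (1 / (1 - q)))"
      by simp
    have "sqrt (2 * pi * \<sigma>\<^sup>2) = sqrt (2 * pi) / sqrt (1 - q)"
      unfolding \<sigma>(2) by (simp add: real_sqrt_divide)
    then have "normal_density (b / (1 - q)) \<sigma> x =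
        sqrt (1 - q) / sqrt (2 * pi) * exp (- (x - b / (1 - q))\<^sup>2 / (2 * (1 / (1 - q))))"
      unfolding normal_density_def \<sigma>(2) by simp
    then have "std_normal_density x * exp (b * x + q * x\<^sup>2 / 2) =
        exp (b\<^sup>2 / (2 * (1 - q))) / sqrt (1 - q) * normal_density (b / (1 - q)) \<sigma> x"
      using q e by (simp add: std_normal_density_def mult.assoc flip: exp_add)
    then show "ennreal (std_normal_density x) * ennreal (exp (b * x + q * x\<^sup>2 / 2)) =
        ennreal (exp (b\<^sup>2 / (2 * (1 - q))) / sqrt (1 - q)) *
        ennreal (normal_density (b / (1 - q)) \<sigma> x)"
      using q by (simp flip: ennreal_mult)
  qed
  also have "\<dots> = ennreal (exp (b\<^sup>2 / (2 * (1 - q))) / sqrt (1 - q)) *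
      (\<integral>\<^sup>+x. ennreal (normal_density (b / (1 - q)) \<sigma> x) \<partial>lborel)"
    by (rule nn_integral_cmult) simp
  also have "(\<integral>\<^sup>+x. ennreal (normal_density (b / (1 - q)) \<sigma> x) \<partial>lborel) = 1"
    using prob_space.emeasure_space_1[OF prob_space_normal_density[OF \<sigma>(1), of "b / (1 - q)"]]
    by (simp add: emeasure_density)
  finally show ?thesis by simp
qed

lemma nn_integral_std_gauss_exp:
  "(\<integral>\<^sup>+x. ennreal (exp (\<Sum>i<p. u i * x i)) \<partial>std_gauss p) = ennreal (exp ((\<Sum>i<p. (u i)\<^sup>2) / 2))"
proof -
  interpret N: prob_space "density lborel std_normal_density"
    by (rule prob_space_normal_density) simp
  interpret product_sigma_finite "\<lambda>_::nat. density lborel std_normal_density" by unfold_locales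
  have "(\<integral>\<^sup>+x. ennreal (exp (\<Sum>i<p. u i * x i)) \<partial>std_gauss p) =
      (\<integral>\<^sup>+x. (\<Prod>i<p. ennreal (exp (u i * x i))) \<partial>std_gauss p)"
    by (simp add: exp_sum prod_ennreal)
  also have "\<dots> = (\<Prod>i<p. \<integral>\<^sup>+t. ennreal (exp (u i * t)) \<partial>density lborel std_normal_density)"
    by (rule product_nn_integral_prod) simp_all
  also have "\<dots> = (\<Prod>i<p. ennreal (exp ((u i)\<^sup>2 / 2)))"
    using nn_integral_std_normal_exp_quadratic[of 0] by simp
  also have "\<dots> = ennreal (exp ((\<Sum>i<p. (u i)\<^sup>2) / 2))"
    by (simp add: prod_ennreal exp_sum sum_divide_distrib)
  finally show ?thesis .
qed

lemma spike_lik_nonneg: "0 \<le> e \<Longrightarrow> 0 \<le> spike_lik p a e v x"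
  by (simp add: spike_lik_def)

text \<open>
  Gaussian linearisation: the exponential of a square is a Gaussian average of exponentials of linear
  functions. Probabilistically, \<open>N(0, I + e v v\<^sup>T)\<close> is \<open>N(0, I)\<close> shifted by \<open>sqrt e t v\<close> with \<open>t\<close> standard
  normal.
\<close>

lemma spike_lik_eq_mixture:
  assumes "0 \<le> e"
  shows "ennreal (spike_lik p 1 e v x) =
    (\<integral>\<^sup>+t. ennreal (exp (sqrt e * (\<Sum>j<p. v j * x j) * t + (- e) * t\<^sup>2 / 2)) \<partial>density lborel std_normal_density)"
  using assms
  by (subst nn_integral_std_normal_exp_quadratic) (simp_all add: spike_lik_def power_mult_distrib)

text \<open>
  After linearising both factors, the integral over \<open>x\<close> is a Gaussian moment generating function, and the
  remaining integral of \<open>exp (e \<langle>v, w\<rangle> s t)\<close> over two standard normal variables is one-dimensional twice.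
\<close>

lemma spike_lik_product_std_gauss:
  assumes v: "unit_direction p v" and w: "unit_direction p w" and e: "0 \<le> e"
    and \<rho>: "(e * (\<Sum>i<p. v i * w i))\<^sup>2 < 1"
  shows "(\<integral>\<^sup>+x. ennreal (spike_lik p 1 e v x) * ennreal (spike_lik p 1 e w x) \<partial>std_gauss p) =
    ennreal (1 / sqrt (1 - (e * (\<Sum>i<p. v i * w i))\<^sup>2))"
proof -
  define \<rho> where "\<rho> = (\<Sum>i<p. v i * w i)"
  let ?N = "density lborel std_normal_density"
  let ?G = "std_gauss p"
  define A where "A u t x = ennreal (exp (sqrt e * (\<Sum>j<p. u j * x j) * t + (- e) * t\<^sup>2 / 2))"
    for u :: "nat \<Rightarrow> real" and t :: real and x :: "nat \<Rightarrow> real"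
  interpret N: prob_space ?N by (rule prob_space_normal_density) simp
  interpret G: prob_space ?G by (rule prob_space_std_gauss)
  interpret GN: pair_sigma_finite ?G ?N by unfold_locales
  have A [measurable]: "(\<lambda>(x, t). A u t x) \<in> borel_measurable (?G \<Otimes>\<^sub>M ?N)" for u
    unfolding A_def by measurable
  have Ax [measurable]: "(\<lambda>x. A u t x) \<in> borel_measurable ?G" for u t
    unfolding A_def by measurable
  have At [measurable]: "(\<lambda>t. A u t x) \<in> borel_measurable ?N" for u x
    unfolding A_def by measurable
  have inner: "(\<integral>\<^sup>+x. A v s x * A w t x \<partial>?G) = ennreal (exp (e * \<rho> * s * t))" for s t
  proof -
    have "(\<Sum>i<p. (sqrt e * (v i * s + w i * t))\<^sup>2) =
        (\<Sum>i<p. e * s\<^sup>2 * (v i)\<^sup>2 + e * t\<^sup>2 * (w i)\<^sup>2 + 2 * e * s * t * (v i * w i))"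
      using e by (intro sum.cong refl) (simp add: power_mult_distrib power2_sum algebra_simps)
    also have "\<dots> = e * s\<^sup>2 + e * t\<^sup>2 + 2 * e * s * t * \<rho>"
      using v w by (simp add: unit_direction_def \<rho>_def sum.distrib flip: sum_distrib_left)
    finally have norm: "(\<Sum>i<p. (sqrt e * (v i * s + w i * t))\<^sup>2) = \<dots>" .
    have lin: "(\<Sum>i<p. sqrt e * (v i * s + w i * t) * x i) =
        sqrt e * (\<Sum>j<p. v j * x j) * s + sqrt e * (\<Sum>j<p. w j * x j) * t" for x
      by (simp add: sum_distrib_left sum_distrib_right algebra_simps flip: sum.distrib)
    have "A v s x * A w t x = ennreal (exp (- e * (s\<^sup>2 + t\<^sup>2) / 2)) *
        ennreal (exp (\<Sum>i<p. sqrt e * (v i * s + w i * t) * x i))" for x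
    proof -
      have "(sqrt e * (\<Sum>j<p. v j * x j) * s + (- e) * s\<^sup>2 / 2) +
          (sqrt e * (\<Sum>j<p. w j * x j) * t + (- e) * t\<^sup>2 / 2) =
          - e * (s\<^sup>2 + t\<^sup>2) / 2 + (\<Sum>i<p. sqrt e * (v i * s + w i * t) * x i)"
        unfolding lin by (simp add: field_simps)
      then have "exp (sqrt e * (\<Sum>j<p. v j * x j) * s + (- e) * s\<^sup>2 / 2) *
          exp (sqrt e * (\<Sum>j<p. w j * x j) * t + (- e) * t\<^sup>2 / 2) =
          exp (- e * (s\<^sup>2 + t\<^sup>2) / 2) * exp (\<Sum>i<p. sqrt e * (v i * s + w i * t) * x i)"
        by (simp only: exp_add[symmetric])
      then show ?thesis
        unfolding A_def by (simp only: ennreal_mult[OF exp_ge_zero exp_ge_zero, symmetric])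
    qed
    then have "(\<integral>\<^sup>+x. A v s x * A w t x \<partial>?G) = ennreal (exp (- e * (s\<^sup>2 + t\<^sup>2) / 2)) *
        (\<integral>\<^sup>+x. ennreal (exp (\<Sum>i<p. sqrt e * (v i * s + w i * t) * x i)) \<partial>?G)"
      by (simp add: nn_integral_cmult)
    also have "\<dots> = ennreal (exp (- e * (s\<^sup>2 + t\<^sup>2) / 2 + (e * s\<^sup>2 + e * t\<^sup>2 + 2 * e * s * t * \<rho>) / 2))"
      unfolding nn_integral_std_gauss_exp norm
      by (simp only: exp_add ennreal_mult[OF exp_ge_zero exp_ge_zero])
    also have "- e * (s\<^sup>2 + t\<^sup>2) / 2 + (e * s\<^sup>2 + e * t\<^sup>2 + 2 * e * s * t * \<rho>) / 2 = e * \<rho> * s * t"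
      by (simp add: field_simps)
    finally show ?thesis .
  qed
  have "(\<integral>\<^sup>+x. ennreal (spike_lik p 1 e v x) * ennreal (spike_lik p 1 e w x) \<partial>?G) =
      (\<integral>\<^sup>+x. (\<integral>\<^sup>+s. A v s x \<partial>?N) * (\<integral>\<^sup>+t. A w t x \<partial>?N) \<partial>?G)"
    unfolding A_def by (intro nn_integral_cong) (simp only: spike_lik_eq_mixture[OF e])
  also have "\<dots> = (\<integral>\<^sup>+x. (\<integral>\<^sup>+s. A v s x * (\<integral>\<^sup>+t. A w t x \<partial>?N) \<partial>?N) \<partial>?G)"
    by (intro nn_integral_cong nn_integral_multc[symmetric]) measurable
  also have "\<dots> = (\<integral>\<^sup>+s. (\<integral>\<^sup>+x. A v s x * (\<integral>\<^sup>+t. A w t x \<partial>?N) \<partial>?G) \<partial>?N)"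
    by (intro GN.Fubini'[symmetric]) measurable
  also have "\<dots> = (\<integral>\<^sup>+s. (\<integral>\<^sup>+x. (\<integral>\<^sup>+t. A v s x * A w t x \<partial>?N) \<partial>?G) \<partial>?N)"
    by (intro nn_integral_cong nn_integral_cmult[symmetric]) measurable
  also have "\<dots> = (\<integral>\<^sup>+s. (\<integral>\<^sup>+t. (\<integral>\<^sup>+x. A v s x * A w t x \<partial>?G) \<partial>?N) \<partial>?N)"
    by (intro nn_integral_cong GN.Fubini'[symmetric]) measurable
  also have "\<dots> = (\<integral>\<^sup>+s. (\<integral>\<^sup>+t. ennreal (exp ((e * \<rho> * s) * t + 0 * t\<^sup>2 / 2)) \<partial>?N) \<partial>?N)"
    by (simp add: inner)
  also have "\<dots> = (\<integral>\<^sup>+s. ennreal (exp (0 * s + (e * \<rho>)\<^sup>2 * s\<^sup>2 / 2)) \<partial>?N)"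
    by (subst nn_integral_std_normal_exp_quadratic) (simp_all add: power_mult_distrib)
  also have "\<dots> = ennreal (1 / sqrt (1 - (e * \<rho>)\<^sup>2))"
    using \<rho> by (subst nn_integral_std_normal_exp_quadratic) (simp_all add: \<rho>_def)
  finally show ?thesis by (simp add: \<rho>_def)
qed

lemma prob_space_gaussian_scalar:
  assumes "1 \<le> p" "0 < a"
  shows "prob_space (gaussian p (a \<cdot>\<^sub>m 1\<^sub>m p))"
  unfolding gaussian_scalar[OF assms]
  by (intro prob_space.prob_space_distr prob_space_std_gauss) measurable

lemma sets_gaussian [simp, measurable_cong]: "sets (gaussian p S) = sets (R_space p)"
  by (simp add: gaussian_def)

lemma prob_space_gaussian_spike:
  assumes "unit_direction p v" "0 < a" "0 \<le> e"
  shows "prob_space (gaussian p (spike p a (a * e) v))"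
proof -
  have "(1 + (sqrt (1 + e) - 1))\<^sup>2 - 1 = e" using assms(3) by simp
  then have "gaussian p (spike p a (a * e) v) = distr (std_gauss p) (R_space p)
      (\<lambda>x. scaling p (sqrt a) (rank_one_map p (sqrt (1 + e) - 1) v x))"
    using gaussian_spike_eq_distr[OF assms(1,2), of "sqrt (1 + e) - 1"] assms(3) by simp
  then show ?thesis
    by (auto intro!: prob_space.prob_space_distr prob_space_std_gauss)
qed

lemma spike_lik_product:
  assumes "1 \<le> p" and a: "0 < a"
    and "unit_direction p v" "unit_direction p w" "0 \<le> e" "(e * (\<Sum>i<p. v i * w i))\<^sup>2 < 1"
  shows "(\<integral>\<^sup>+x. ennreal (spike_lik p a e v x) * ennreal (spike_lik p a e w x)
      \<partial>gaussian p (a \<cdot>\<^sub>m 1\<^sub>m p)) = ennreal (1 / sqrt (1 - (e * (\<Sum>i<p. v i * w i))\<^sup>2))"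
  unfolding gaussian_scalar[OF assms(1,2)]
  using spike_lik_product_std_gauss[OF assms(3-6)]
  by (subst nn_integral_distr) (simp_all add: spike_lik_scaling[OF a])

definition sample_lik ::
  "nat \<Rightarrow> nat \<Rightarrow> real \<Rightarrow> real \<Rightarrow> (nat \<Rightarrow> real) \<Rightarrow> (nat \<Rightarrow> nat \<Rightarrow> real) \<Rightarrow> real" where
  "sample_lik n p a e v X = (\<Prod>i<n. spike_lik p a e v (X i))"

lemma sample_lik_nonneg: "0 \<le> e \<Longrightarrow> 0 \<le> sample_lik n p a e v X"
  by (simp add: sample_lik_def prod_nonneg spike_lik_nonneg)

lemma measurable_sample_lik [measurable]:
  "sample_lik n p a e v \<in> borel_measurable (PiM {..<n} (\<lambda>_. R_space p))"
  unfolding sample_lik_def[abs_def] by measurable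

lemma PiM_gaussian_spike_eq_density:
  assumes v: "unit_direction p v" and p: "1 \<le> p" and a: "0 < a" and e: "0 \<le> e"
  shows "PiM {..<n} (\<lambda>_. gaussian p (spike p a (a * e) v)) =
    density (PiM {..<n} (\<lambda>_. gaussian p (a \<cdot>\<^sub>m 1\<^sub>m p))) (sample_lik n p a e v)"
proof -
  interpret P: prob_space "gaussian p (a \<cdot>\<^sub>m 1\<^sub>m p)" by (rule prob_space_gaussian_scalar[OF p a])
  interpret Q: prob_space "gaussian p (spike p a (a * e) v)"
    by (rule prob_space_gaussian_spike[OF v a e])
  have "PiM {..<n} (\<lambda>_. gaussian p (spike p a (a * e) v)) =
      density (PiM {..<n} (\<lambda>_. gaussian p (a \<cdot>\<^sub>m 1\<^sub>m p))) (\<lambda>X. \<Prod>i<n. ennreal (spike_lik p a e v (X i)))"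
    unfolding gaussian_spike_eq_density[OF assms]
  proof (rule PiM_density)
    show "sigma_finite_measure (density (gaussian p (a \<cdot>\<^sub>m 1\<^sub>m p)) (spike_lik p a e v))"
      using Q.sigma_finite_measure gaussian_spike_eq_density[OF assms] by simp
  qed (auto intro: P.sigma_finite_measure)
  then show ?thesis
    using e by (simp add: sample_lik_def[abs_def] prod_ennreal spike_lik_nonneg)
qed

lemma sample_lik_product:
  assumes p: "1 \<le> p" and a: "0 < a"
    and vw: "unit_direction p v" "unit_direction p w" and e: "0 \<le> e"
    and \<rho>: "(e * (\<Sum>i<p. v i * w i))\<^sup>2 < 1"
  shows "(\<integral>\<^sup>+X. ennreal (sample_lik n p a e v X) * ennreal (sample_lik n p a e w X)
      \<partial>PiM {..<n} (\<lambda>_. gaussian p (a \<cdot>\<^sub>m 1\<^sub>m p))) =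
    ennreal ((1 / sqrt (1 - (e * (\<Sum>i<p. v i * w i))\<^sup>2)) ^ n)"
proof -
  interpret P: prob_space "gaussian p (a \<cdot>\<^sub>m 1\<^sub>m p)" by (rule prob_space_gaussian_scalar[OF p a])
  interpret product_sigma_finite "\<lambda>_::nat. gaussian p (a \<cdot>\<^sub>m 1\<^sub>m p)" by unfold_locales
  have "(\<integral>\<^sup>+X. ennreal (sample_lik n p a e v X) * ennreal (sample_lik n p a e w X)
      \<partial>PiM {..<n} (\<lambda>_. gaussian p (a \<cdot>\<^sub>m 1\<^sub>m p))) =
      (\<integral>\<^sup>+X. (\<Prod>i<n. ennreal (spike_lik p a e v (X i)) * ennreal (spike_lik p a e w (X i)))
      \<partial>PiM {..<n} (\<lambda>_. gaussian p (a \<cdot>\<^sub>m 1\<^sub>m p)))"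
    using e by (simp add: sample_lik_def prod.distrib prod_ennreal spike_lik_nonneg)
  also have "\<dots> = (\<Prod>i<n. \<integral>\<^sup>+x. ennreal (spike_lik p a e v x) * ennreal (spike_lik p a e w x)
      \<partial>gaussian p (a \<cdot>\<^sub>m 1\<^sub>m p))"
    by (rule product_nn_integral_prod) simp_all
  also have "\<dots> = ennreal ((1 / sqrt (1 - (e * (\<Sum>i<p. v i * w i))\<^sup>2)) ^ n)"
    unfolding spike_lik_product[OF assms] using \<rho> by (simp add: ennreal_power)
  finally show ?thesis .
qed


section \<open>Testing against a mixture\<close>

text \<open>
  The method of Le Cam for a null hypothesis \<open>M\<close> and the mixture of the alternatives with densities \<open>g v\<close>.
  If \<open>A\<close> is rare under \<open>M\<close>, then a bound on the second moment of the mixture density makes it rare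
  under the mixture, so some alternative gives the complement of \<open>A\<close> a substantial probability.
\<close>

lemma mixture_test_lower_bound:
  fixes g :: "'v \<Rightarrow> 'a \<Rightarrow> real"
  assumes V: "finite V" "V \<noteq> {}"
    and g [measurable]: "\<And>v. v \<in> V \<Longrightarrow> g v \<in> borel_measurable M"
    and nonneg: "\<And>v x. v \<in> V \<Longrightarrow> 0 \<le> g v x"
    and prob: "\<And>v. v \<in> V \<Longrightarrow> prob_space (density M (g v))"
    and K: "1 \<le> K"
    and second_moment: "(\<Sum>v\<in>V. \<Sum>w\<in>V. \<integral>\<^sup>+x. ennreal (g v x) * ennreal (g w x) \<partial>M) \<le>
      ennreal (K * (real (card V))\<^sup>2)"
    and A [measurable]: "A \<in> sets M"
  shows "ennreal (1 / (4 * K)) \<le> emeasure M A \<or>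
    (\<exists>v\<in>V. ennreal (1 / (4 * K)) \<le> emeasure (density M (g v)) (space M - A))"
proof (rule ccontr)
  assume "\<not> ?thesis"
  then have small: "emeasure M A < ennreal (1 / (4 * K))"
    "\<And>v. v \<in> V \<Longrightarrow> emeasure (density M (g v)) (space M - A) < ennreal (1 / (4 * K))"
    by (auto simp: not_le)
  define m where "m = real (card V)"
  have m: "0 < m" using V by (simp add: m_def card_gt_0_iff)
  define G where "G x = (\<Sum>v\<in>V. g v x)" for x
  have G [measurable]: "G \<in> borel_measurable M" unfolding G_def by measurable
  \<comment> \<open>The weights in this arithmetic-geometric mean inequality make the two integrals below contribute
    at most \<open>m / 4\<close> each, out of a total mass \<open>m\<close> of the alternatives.\<close>
  have amgm: "ennreal (G x) * indicator A x \<le>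
      ennreal (1 / (4 * K * m)) * ennreal ((G x)\<^sup>2) + ennreal (K * m) * indicator A x" for x
  proof (cases "x \<in> A")
    case True
    have "0 \<le> (G x - 2 * (K * m))\<^sup>2 / (4 * (K * m))" using K m by simp
    also have "\<dots> = (G x)\<^sup>2 / (4 * (K * m)) - G x + K * m"
      using K m by (simp add: field_simps power2_eq_square)
    finally have "G x \<le> 1 / (4 * K * m) * (G x)\<^sup>2 + K * m" by (simp add: mult.assoc)
    then have "ennreal (G x) \<le> ennreal (1 / (4 * K * m) * (G x)\<^sup>2 + K * m)" by (rule ennreal_leI)
    also have "\<dots> = ennreal (1 / (4 * K * m)) * ennreal ((G x)\<^sup>2) + ennreal (K * m)"
    proof -
      have nn: "0 \<le> 1 / (4 * K * m)" "0 \<le> K * m" using K m by simp_all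
      show ?thesis
        by (simp only: ennreal_plus[OF mult_nonneg_nonneg[OF nn(1) zero_le_power2] nn(2)]
            ennreal_mult[OF nn(1) zero_le_power2])
    qed
    finally show ?thesis
      unfolding indicator_simps(1)[OF True] mult_1_right .
  qed simp
  have "(\<integral>\<^sup>+x. ennreal ((G x)\<^sup>2) \<partial>M) = (\<integral>\<^sup>+x. (\<Sum>v\<in>V. \<Sum>w\<in>V. ennreal (g v x) * ennreal (g w x)) \<partial>M)"
  proof (intro nn_integral_cong)
    fix x
    have "(\<Sum>v\<in>V. \<Sum>w\<in>V. ennreal (g v x) * ennreal (g w x)) =
        (\<Sum>v\<in>V. \<Sum>w\<in>V. ennreal (g v x * g w x))"
      by (intro sum.cong refl ennreal_mult[symmetric] nonneg)
    also have "\<dots> = ennreal (\<Sum>v\<in>V. \<Sum>w\<in>V. g v x * g w x)"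
      by (simp add: nonneg sum_nonneg)
    also have "(\<Sum>v\<in>V. \<Sum>w\<in>V. g v x * g w x) = (G x)\<^sup>2"
      by (simp add: G_def power2_eq_square sum_product)
    finally show "ennreal ((G x)\<^sup>2) = (\<Sum>v\<in>V. \<Sum>w\<in>V. ennreal (g v x) * ennreal (g w x))" by (rule sym)
  qed
  also have "\<dots> = (\<Sum>v\<in>V. \<integral>\<^sup>+x. (\<Sum>w\<in>V. ennreal (g v x) * ennreal (g w x)) \<partial>M)"
    by (intro nn_integral_sum) measurable
  also have "\<dots> = (\<Sum>v\<in>V. \<Sum>w\<in>V. \<integral>\<^sup>+x. ennreal (g v x) * ennreal (g w x) \<partial>M)"
    by (intro sum.cong refl nn_integral_sum) measurable
  finally have G2: "(\<integral>\<^sup>+x. ennreal ((G x)\<^sup>2) \<partial>M) \<le> ennreal (K * m\<^sup>2)"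
    using second_moment by (simp add: m_def)
  have "(\<Sum>v\<in>V. emeasure (density M (g v)) A) = (\<integral>\<^sup>+x. ennreal (G x) * indicator A x \<partial>M)"
  proof -
    have "(\<Sum>v\<in>V. emeasure (density M (g v)) A) = (\<Sum>v\<in>V. \<integral>\<^sup>+x. ennreal (g v x) * indicator A x \<partial>M)"
      by (intro sum.cong refl emeasure_density) measurable
    also have "\<dots> = (\<integral>\<^sup>+x. (\<Sum>v\<in>V. ennreal (g v x) * indicator A x) \<partial>M)"
      by (intro nn_integral_sum[symmetric]) measurable
    also have "\<dots> = (\<integral>\<^sup>+x. ennreal (G x) * indicator A x \<partial>M)"
      by (intro nn_integral_cong) (simp add: G_def nonneg flip: sum_distrib_right)
    finally show ?thesis .
  qed
  also have "\<dots> \<le> (\<integral>\<^sup>+x. ennreal (1 / (4 * K * m)) * ennreal ((G x)\<^sup>2) + ennreal (K * m) * indicator A x \<partial>M)"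
    by (intro nn_integral_mono amgm)
  also have "\<dots> = ennreal (1 / (4 * K * m)) * (\<integral>\<^sup>+x. ennreal ((G x)\<^sup>2) \<partial>M) + ennreal (K * m) * emeasure M A"
    by (simp add: nn_integral_add nn_integral_cmult)
  also have "\<dots> \<le> ennreal (1 / (4 * K * m)) * ennreal (K * m\<^sup>2) + ennreal (K * m) * ennreal (1 / (4 * K))"
    using G2 small(1) by (intro add_mono mult_left_mono) auto
  also have "\<dots> = ennreal (m / 2)"
  proof -
    have "ennreal (1 / (4 * K * m)) * ennreal (K * m\<^sup>2) = ennreal (1 / (4 * K * m) * (K * m\<^sup>2))"
      using K m by (intro ennreal_mult[symmetric]) auto
    also have "1 / (4 * K * m) * (K * m\<^sup>2) = m / 4" using K m by (simp add: power2_eq_square)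
    finally have 1: "ennreal (1 / (4 * K * m)) * ennreal (K * m\<^sup>2) = ennreal (m / 4)" .
    have "ennreal (K * m) * ennreal (1 / (4 * K)) = ennreal (K * m * (1 / (4 * K)))"
      using K m by (intro ennreal_mult[symmetric]) auto
    also have "K * m * (1 / (4 * K)) = m / 4" using K m by simp
    finally have 2: "ennreal (K * m) * ennreal (1 / (4 * K)) = ennreal (m / 4)" .
    have "ennreal (m / 4) + ennreal (m / 4) = ennreal (m / 4 + m / 4)"
      using m by (intro ennreal_plus[symmetric]) auto
    also have "m / 4 + m / 4 = m / 2" by simp
    finally show ?thesis unfolding 1 2 .
  qed
  finally have inA: "(\<Sum>v\<in>V. emeasure (density M (g v)) A) \<le> ennreal (m / 2)" .
  have "(\<Sum>v\<in>V. emeasure (density M (g v)) (space M - A)) \<le> (\<Sum>v\<in>V. ennreal (1 / (4 * K)))"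
    using small(2) by (intro sum_mono) (simp add: less_imp_le)
  also have "\<dots> = ennreal (m * (1 / (4 * K)))"
  proof -
    have "ennreal m * ennreal (1 / (4 * K)) = ennreal (m * (1 / (4 * K)))"
      using K m by (intro ennreal_mult[symmetric]) auto
    then show ?thesis by (simp add: m_def ennreal_of_nat_eq_real_of_nat)
  qed
  also have "\<dots> \<le> ennreal (m / 4)"
    using K m by (intro ennreal_leI) (simp add: field_simps)
  finally have outA: "(\<Sum>v\<in>V. emeasure (density M (g v)) (space M - A)) \<le> ennreal (m / 4)" .
  have "emeasure (density M (g v)) A + emeasure (density M (g v)) (space M - A) = 1" if "v \<in> V" for v
  proof -
    interpret prob_space "density M (g v)" using that by (rule prob)
    have "emeasure (density M (g v)) A + emeasure (density M (g v)) (space M - A) =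
        emeasure (density M (g v)) (A \<union> (space M - A))"
      by (intro plus_emeasure) auto
    also have "A \<union> (space M - A) = space (density M (g v))"
      using sets.sets_into_space[OF A] by auto
    finally show ?thesis using emeasure_space_1 by simp
  qed
  then have "(\<Sum>v\<in>V. emeasure (density M (g v)) A + emeasure (density M (g v)) (space M - A)) = (\<Sum>v\<in>V. 1)"
    by (rule sum.cong[OF refl])
  then have "ennreal m = (\<Sum>v\<in>V. emeasure (density M (g v)) A) +
      (\<Sum>v\<in>V. emeasure (density M (g v)) (space M - A))"
    by (simp add: sum.distrib m_def ennreal_of_nat_eq_real_of_nat)
  also have "\<dots> \<le> ennreal (m / 2) + ennreal (m / 4)" by (intro add_mono inA outA)
  also have "\<dots> = ennreal (3 * m / 4)" 
    using m by (subst ennreal_plus[symmetric]) auto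
  finally have "m \<le> 3 * m / 4" using m by (subst (asm) ennreal_le_iff) auto
  then show False using m by simp
qed


section \<open>Exponential moments\<close>

text \<open>
  The two power series are compared term by term: \<open>2 ^ k * fact k \<le> fact (2 * k)\<close>.
\<close>

lemma cosh_le_exp: "cosh (x::real) \<le> exp (x\<^sup>2 / 2)"
proof -
  have fact: "2 ^ k * fact k \<le> (fact (2 * k) :: real)" for k
  proof (induction k)
    case (Suc k)
    have "2 ^ Suc k * fact (Suc k) = 2 * real (Suc k) * (2 ^ k * fact k :: real)" by simp
    also have "\<dots> \<le> real (2 * k + 2) * real (2 * k + 1) * fact (2 * k)"
      using Suc by (intro mult_mono) auto
    also have "\<dots> = fact (2 * Suc k)" by simp
    finally show ?case .
  qed simp
  define f where "f n = (if even n then x ^ n /\<^sub>R fact n else 0)" for n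
  have "f sums cosh x" unfolding f_def by (rule cosh_converges)
  then have "(\<lambda>k. f (2 * k)) sums cosh x"
    by (subst sums_mono_reindex) (auto simp: strict_mono_def f_def elim!: evenE)
  moreover have "(\<lambda>k. (x\<^sup>2 / 2) ^ k /\<^sub>R fact k) sums exp (x\<^sup>2 / 2)" by (rule exp_converges)
  moreover have "f (2 * k) \<le> (x\<^sup>2 / 2) ^ k /\<^sub>R fact k" for k
  proof -
    have "f (2 * k) = x ^ (2 * k) /\<^sub>R fact (2 * k)" by (simp add: f_def)
    also have "\<dots> = (x\<^sup>2) ^ k / fact (2 * k)"
      unfolding power_mult[of x 2 k] real_scaleR_def divide_inverse by (rule mult.commute)
    also have "\<dots> \<le> (x\<^sup>2) ^ k / (2 ^ k * fact k)"
      using fact by (intro divide_left_mono) auto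
    also have "\<dots> = (x\<^sup>2 / 2) ^ k /\<^sub>R fact k" by (simp add: power_divide field_simps)
    finally show ?thesis .
  qed
  ultimately show ?thesis by (rule sums_le[rotated])
qed

text \<open>
  A sum of random signs is subgaussian, and so its square has an exponential moment. The square is
  linearised by a Gaussian average, after which the sum over the signs factors into hyperbolic cosines.
\<close>

lemma sum_sign_exp_square_le:
  fixes l :: real and s :: "nat \<Rightarrow> real"
  assumes l: "0 \<le> l" "2 * l / real m < 1" and s: "\<And>i. i < m \<Longrightarrow> s i = 1 \<or> s i = - 1"
  shows "(\<Sum>t\<in>PiE {..<m} (\<lambda>_. {- 1, 1}). exp (l * ((\<Sum>i<m. s i * t i) / real m)\<^sup>2)) \<le>
    2 ^ m * (1 / sqrt (1 - 2 * l / real m))"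
proof (cases "m = 0")
  case False
  then have m: "0 < real m" by simp
  \<comment> \<open>Chosen so that \<open>(b S)\<^sup>2 / 2\<close> is the exponent for a sum \<open>S\<close>.\<close>
  define b where "b = sqrt (2 * l) / real m"
  let ?N = "density lborel std_normal_density"
  let ?T = "PiE {..<m} (\<lambda>_. {- 1, 1 :: real})"
  have gauss: "(\<integral>\<^sup>+x. ennreal (exp (c * x + 0 * x\<^sup>2 / 2)) \<partial>?N) = ennreal (exp (c\<^sup>2 / 2))" for c
    using nn_integral_std_normal_exp_quadratic[of 0 c] by simp
  have "ennreal (\<Sum>t\<in>?T. exp (l * ((\<Sum>i<m. s i * t i) / real m)\<^sup>2)) =
      (\<Sum>t\<in>?T. \<integral>\<^sup>+x. ennreal (exp (b * (\<Sum>i<m. s i * t i) * x + 0 * x\<^sup>2 / 2)) \<partial>?N)"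
  proof -
    have "(b * S)\<^sup>2 / 2 = l * (S / real m)\<^sup>2" for S
      using l by (simp add: b_def power_mult_distrib power_divide)
    then show ?thesis unfolding gauss by (subst sum_ennreal) simp_all
  qed
  also have "\<dots> = (\<integral>\<^sup>+x. (\<Sum>t\<in>?T. ennreal (exp (b * (\<Sum>i<m. s i * t i) * x + 0 * x\<^sup>2 / 2))) \<partial>?N)"
    by (rule nn_integral_sum[symmetric]) simp
  also have "\<dots> \<le> (\<integral>\<^sup>+x. ennreal (2 ^ m) * ennreal (exp (0 * x + (2 * l / real m) * x\<^sup>2 / 2)) \<partial>?N)"
  proof (rule nn_integral_mono)
    fix x
    have "(\<Sum>t\<in>?T. exp (b * (\<Sum>i<m. s i * t i) * x + 0 * x\<^sup>2 / 2)) = (\<Sum>t\<in>?T. \<Prod>i<m. exp (b * x * s i * t i))"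
    proof (intro sum.cong refl)
      fix t
      have "b * (\<Sum>i<m. s i * t i) * x + 0 * x\<^sup>2 / 2 = (\<Sum>i<m. b * x * s i * t i)"
        by (simp add: sum_distrib_left mult.left_commute mult.commute)
      then show "exp (b * (\<Sum>i<m. s i * t i) * x + 0 * x\<^sup>2 / 2) = (\<Prod>i<m. exp (b * x * s i * t i))"
        by (simp only: exp_sum[OF finite_lessThan])
    qed
    also have "\<dots> = (\<Prod>i<m. \<Sum>y\<in>{- 1, 1}. exp (b * x * s i * y))"
      by (rule prod_sum_PiE[symmetric]) auto
    also have "\<dots> = (\<Prod>i<m. 2 * cosh (b * x))"
    proof (intro prod.cong refl)
      fix i assume "i \<in> {..<m}"
      then have "s i = 1 \<or> s i = - 1" by (intro s) simp
      then show "(\<Sum>y\<in>{- 1, 1}. exp (b * x * s i * y)) = 2 * cosh (b * x)"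
        by (auto simp: cosh_field_def)
    qed
    also have "\<dots> \<le> (\<Prod>i<m. 2 * exp ((b * x)\<^sup>2 / 2))"
      by (intro prod_mono conjI mult_left_mono cosh_le_exp) simp_all
    also have "\<dots> = 2 ^ m * exp (real m * ((b * x)\<^sup>2 / 2))"
      by (simp only: prod_constant card_lessThan power_mult_distrib exp_of_nat_mult)
    also have "real m * ((b * x)\<^sup>2 / 2) = 0 * x + (2 * l / real m) * x\<^sup>2 / 2"
      using m l by (simp add: b_def power_mult_distrib power_divide) (simp add: power2_eq_square)
    finally have "(\<Sum>t\<in>?T. exp (b * (\<Sum>i<m. s i * t i) * x + 0 * x\<^sup>2 / 2)) \<le>
        2 ^ m * exp (0 * x + (2 * l / real m) * x\<^sup>2 / 2)" .
    then show "(\<Sum>t\<in>?T. ennreal (exp (b * (\<Sum>i<m. s i * t i) * x + 0 * x\<^sup>2 / 2))) \<le>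
        ennreal (2 ^ m) * ennreal (exp (0 * x + (2 * l / real m) * x\<^sup>2 / 2))"
      unfolding ennreal_mult[OF zero_le_power[OF zero_le_numeral] exp_ge_zero, symmetric]
      by (subst sum_ennreal) (simp_all only: exp_ge_zero ennreal_leI)
  qed
  also have "\<dots> = ennreal (2 ^ m) * ennreal (1 / sqrt (1 - 2 * l / real m))"
    using l nn_integral_std_normal_exp_quadratic[OF l(2), of 0]
    by (subst nn_integral_cmult) simp_all
  also have "\<dots> = ennreal (2 ^ m * (1 / sqrt (1 - 2 * l / real m)))"
    using l by (intro ennreal_mult[symmetric]) auto
  finally show ?thesis
    using l by (subst (asm) ennreal_le_iff) auto
qed simp

text \<open>
  This replaces the inner products of likelihood ratios by exponentials, which are easier to average.
\<close>

lemma inverse_sqrt_le_exp: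
  assumes "0 \<le> y" "y \<le> 1 / 2"
  shows "1 / sqrt (1 - y) \<le> exp (y::real)"
proof -
  have "0 \<le> y * (1 - 2 * y)" using assms by simp
  then have "1 \<le> (1 + 2 * y) * (1 - y)" by (simp add: algebra_simps)
  also have "\<dots> \<le> exp (2 * y) * (1 - y)"
    using assms exp_ge_add_one_self[of "2 * y"] by (intro mult_right_mono) auto
  also have "\<dots> = (exp y)\<^sup>2 * (1 - y)" by (simp flip: exp_double)
  finally have "1 \<le> sqrt ((exp y)\<^sup>2 * (1 - y))" by simp
  then have "1 \<le> exp y * sqrt (1 - y)" by (simp add: real_sqrt_mult)
  then show ?thesis using assms by (simp add: divide_le_eq)
qed


section \<open>Error probabilities in the contamination model\<close>

definition worst_case_prob ::
  "nat \<Rightarrow> nat \<Rightarrow> real \<Rightarrow> real mat set \<Rightarrow> ((nat \<Rightarrow> nat \<Rightarrow> real) \<Rightarrow> real mat) \<Rightarrow> real \<Rightarrow> ennreal" where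
  "worst_case_prob n p \<epsilon> F T r = (SUP S \<in> F. SUP Q \<in> prob_distributions p.
     emeasure (sample_law n p \<epsilon> S Q)
       {X \<in> space (sample_law n p \<epsilon> S Q). (op_norm (T X - S))\<^sup>2 \<ge> r})"

definition error_event ::
  "nat \<Rightarrow> nat \<Rightarrow> ((nat \<Rightarrow> nat \<Rightarrow> real) \<Rightarrow> real mat) \<Rightarrow> real mat \<Rightarrow> real \<Rightarrow> (nat \<Rightarrow> nat \<Rightarrow> real) set" where
  "error_event n p T S r =
     {X \<in> space (PiM {..<n} (\<lambda>_. R_space p)). (op_norm (T X - S))\<^sup>2 \<ge> r}"

lemma sets_error_event:
  assumes "T \<in> estimators n p" "S \<in> carrier_mat p p"
  shows "error_event n p T S r \<in> sets (PiM {..<n} (\<lambda>_. R_space p))"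
proof -
  note measurable_op_norm_error[OF assms, measurable]
  show ?thesis unfolding error_event_def by measurable
qed

text \<open>
  An estimate closer than half the separation to the null matrix is at least that far from the spike.
\<close>

lemma error_event_spike_cover:
  assumes T: "T \<in> estimators n p" and v: "unit_direction p v" and d: "0 \<le> d" and r: "4 * r \<le> d\<^sup>2"
  shows "space (PiM {..<n} (\<lambda>_. R_space p)) - error_event n p T (a \<cdot>\<^sub>m 1\<^sub>m p) r \<subseteq>
    error_event n p T (spike p a d v) r"
proof
  fix X assume "X \<in> space (PiM {..<n} (\<lambda>_. R_space p)) - error_event n p T (a \<cdot>\<^sub>m 1\<^sub>m p) r"
  then have X: "X \<in> space (PiM {..<n} (\<lambda>_. R_space p))" and
    less: "(op_norm (T X - a \<cdot>\<^sub>m 1\<^sub>m p))\<^sup>2 < r" by (auto simp: error_event_def)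
  have TX: "T X \<in> carrier_mat p p" using T X by (rule estimator_carrier)
  have nn: "0 \<le> op_norm (T X - a \<cdot>\<^sub>m 1\<^sub>m p)" "0 \<le> op_norm (T X - spike p a d v)"
    by (auto intro!: op_norm_nonneg[of _ p] minus_carrier_mat)
  have r_pos: "0 \<le> r" using less zero_le_power2 by (meson less_imp_le order_trans)
  have "op_norm (T X - a \<cdot>\<^sub>m 1\<^sub>m p) \<le> sqrt r"
    using less nn(1) by (intro real_le_rsqrt) simp
  moreover have "2 * sqrt r \<le> d"
  proof -
    have "(2 * sqrt r)\<^sup>2 \<le> d\<^sup>2" using r r_pos by (simp add: power_mult_distrib)
    then show ?thesis using d by (rule power2_le_imp_le)
  qed
  moreover have "d \<le> op_norm (T X - a \<cdot>\<^sub>m 1\<^sub>m p) + op_norm (T X - spike p a d v)"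
    using spike_separation[OF v d TX, of a] by simp
  ultimately have "sqrt r \<le> op_norm (T X - spike p a d v)" by linarith
  then have "r \<le> (op_norm (T X - spike p a d v))\<^sup>2"
    using r_pos by (metis power_mono real_sqrt_ge_zero real_sqrt_pow2)
  then show "X \<in> error_event n p T (spike p a d v) r"
    using X by (simp add: error_event_def)
qed

lemma contaminated_eqI:
  assumes P: "sets P = sets (R_space p)"
    and eq: "\<And>A. A \<in> sets (R_space p) \<Longrightarrow>
      ennreal (1 - \<epsilon>) * emeasure (gaussian p S) A + ennreal \<epsilon> * emeasure Q A = emeasure P A"
  shows "contaminated p \<epsilon> S Q = P"
proof -
  have "contaminated p \<epsilon> S Q = measure_of (space (R_space p)) (sets (R_space p)) (emeasure P)"
    unfolding contaminated_def using eq
    by (intro measure_of_eq sets.space_closed) (simp add: sets.sigma_sets_eq)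
  also have "\<dots> = P"
    using P sets_eq_imp_space_eq[OF P] measure_of_of_measure[of P] by simp
  finally show ?thesis .
qed

text \<open>
  Contaminating a law by itself leaves it unchanged, so uncontaminated Gaussian samples are available for
  every \<open>\<epsilon>\<close>.
\<close>

lemma contaminated_gaussian:
  assumes "\<epsilon> \<in> {0..1}"
  shows "contaminated p \<epsilon> S (gaussian p S) = gaussian p S"
proof (rule contaminated_eqI)
  fix A
  have "ennreal (1 - \<epsilon>) + ennreal \<epsilon> = 1"
    using assms by (simp flip: ennreal_plus)
  then show "ennreal (1 - \<epsilon>) * emeasure (gaussian p S) A + ennreal \<epsilon> * emeasure (gaussian p S) A =
      emeasure (gaussian p S) A"
    by (metis distrib_right mult_1)
qed simp

lemma worst_case_prob_ge:
  assumes "S \<in> F" "Q \<in> prob_distributions p" "contaminated p \<epsilon> S Q = P" "sets P = sets (R_space p)"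
    and "c \<le> emeasure (PiM {..<n} (\<lambda>_. P)) (error_event n p T S r)"
  shows "c \<le> worst_case_prob n p \<epsilon> F T r"
proof -
  have "sets (PiM {..<n} (\<lambda>_. P)) = sets (PiM {..<n} (\<lambda>_. R_space p))"
    using assms(4) by (intro sets_PiM_cong) auto
  then have "space (PiM {..<n} (\<lambda>_. P)) = space (PiM {..<n} (\<lambda>_. R_space p))"
    by (rule sets_eq_imp_space_eq)
  then have "c \<le> emeasure (sample_law n p \<epsilon> S Q)
       {X \<in> space (sample_law n p \<epsilon> S Q). (op_norm (T X - S))\<^sup>2 \<ge> r}"
    using assms(3,5) by (simp add: sample_law_def error_event_def)
  then show ?thesis
    unfolding worst_case_prob_def using assms(1,2) by (blast intro: SUP_upper2)
qed

lemma unit_direction_inner_le: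
  assumes "unit_direction p v" "unit_direction p w"
  shows "(\<Sum>i<p. v i * w i)\<^sup>2 \<le> 1"
proof -
  have "\<bar>\<Sum>i<p. v i * w i\<bar> \<le> (\<Sum>i<p. \<bar>v i\<bar> * \<bar>w i\<bar>)"
    by (rule order_trans[OF sum_abs]) (simp add: abs_mult)
  also have "\<dots> \<le> L2_set v {..<p} * L2_set w {..<p}" by (rule L2_set_mult_ineq)
  also have "\<dots> = 1" using assms by (simp add: L2_set_def unit_direction_def)
  finally show ?thesis by (simp add: abs_square_le_1)
qed

text \<open>
  The lower bound from statistical uncertainty alone. The hypothesis \<open>corr\<close> says that
  \<open>exp (n (e \<langle>v, w\<rangle>)\<^sup>2)\<close> has mean at most \<open>2\<close> over two independent directions of the family, and \<open>1/8\<close>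
  is the constant \<open>1 / (4 K)\<close> of the testing bound for \<open>K = 2\<close>.
\<close>

lemma worst_case_prob_spike_family:
  fixes v :: "'i \<Rightarrow> nat \<Rightarrow> real"
  assumes p: "1 \<le> p" and \<epsilon>: "\<epsilon> \<in> {0..1}" and T: "T \<in> estimators n p"
    and a: "0 < a" and e: "0 \<le> e" "e \<le> 1 / 2" and r: "4 * r \<le> (a * e)\<^sup>2"
    and I: "finite I" "I \<noteq> {}" and v: "\<And>i. i \<in> I \<Longrightarrow> unit_direction p (v i)"
    and corr: "(\<Sum>i\<in>I. \<Sum>j\<in>I. exp (real n * (e * (\<Sum>k<p. v i k * v j k))\<^sup>2)) \<le> 2 * (real (card I))\<^sup>2"
    and F: "a \<cdot>\<^sub>m 1\<^sub>m p \<in> F" "\<And>i. i \<in> I \<Longrightarrow> spike p a (a * e) (v i) \<in> F"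
  shows "ennreal (1 / 8) \<le> worst_case_prob n p \<epsilon> F T r"
proof -
  let ?Null = "gaussian p (a \<cdot>\<^sub>m 1\<^sub>m p)"
  let ?M = "PiM {..<n} (\<lambda>_. ?Null)"
  let ?Alt = "\<lambda>i. gaussian p (spike p a (a * e) (v i))"
  have sets_M: "sets (PiM {..<n} (\<lambda>_. gaussian p S)) = sets (PiM {..<n} (\<lambda>_. R_space p))" for S
    by (intro sets_PiM_cong) auto
  have space_M: "space ?M = space (PiM {..<n} (\<lambda>_. R_space p))"
    by (rule sets_eq_imp_space_eq[OF sets_M])
  have quarter: "(e * (\<Sum>k<p. v i k * v j k))\<^sup>2 \<le> 1 / 4" if "i \<in> I" "j \<in> I" for i j
  proof -
    have "(e * (\<Sum>k<p. v i k * v j k))\<^sup>2 = e\<^sup>2 * (\<Sum>k<p. v i k * v j k)\<^sup>2"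
      by (rule power_mult_distrib)
    also have "\<dots> \<le> (1 / 2)\<^sup>2 * 1"
      using e unit_direction_inner_le[OF v[OF that(1)] v[OF that(2)]]
      by (intro mult_mono power_mono) auto
    finally show ?thesis by (simp add: power2_eq_square)
  qed
  have density: "PiM {..<n} (\<lambda>_. ?Alt i) = density ?M (sample_lik n p a e (v i))" if "i \<in> I" for i
    by (rule PiM_gaussian_spike_eq_density[OF v[OF that] p a e(1)])
  have prob_P: "prob_space (?Alt i)" if "i \<in> I" for i
    by (rule prob_space_gaussian_spike[OF v[OF that] a e(1)])
  have "ennreal (1 / (4 * 2)) \<le> emeasure ?M (error_event n p T (a \<cdot>\<^sub>m 1\<^sub>m p) r) \<or>
    (\<exists>i\<in>I. ennreal (1 / (4 * 2)) \<le> emeasure (density ?M (sample_lik n p a e (v i)))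
       (space ?M - error_event n p T (a \<cdot>\<^sub>m 1\<^sub>m p) r))"
  proof (rule mixture_test_lower_bound[OF I])
    show "sample_lik n p a e (v i) \<in> borel_measurable ?M" for i
      using measurable_sample_lik by (simp add: measurable_cong_sets[OF sets_M refl])
    show "0 \<le> sample_lik n p a e (v i) X" for i X using e(1) by (rule sample_lik_nonneg)
    show "prob_space (density ?M (sample_lik n p a e (v i)))" if "i \<in> I" for i
      unfolding density[OF that, symmetric] by (intro prob_space_PiM prob_P that)
    show "error_event n p T (a \<cdot>\<^sub>m 1\<^sub>m p) r \<in> sets ?M"
      unfolding sets_M by (rule sets_error_event[OF T]) simp
    have "(\<integral>\<^sup>+X. ennreal (sample_lik n p a e (v i) X) * ennreal (sample_lik n p a e (v j) X) \<partial>?M) \<le>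
        ennreal (exp (real n * (e * (\<Sum>k<p. v i k * v j k))\<^sup>2))" if ij: "i \<in> I" "j \<in> I" for i j
    proof -
      let ?y = "(e * (\<Sum>k<p. v i k * v j k))\<^sup>2"
      have "(1 / sqrt (1 - ?y)) ^ n \<le> exp ?y ^ n"
        using quarter[OF ij] by (intro power_mono inverse_sqrt_le_exp) auto
      moreover have "(\<integral>\<^sup>+X. ennreal (sample_lik n p a e (v i) X) * ennreal (sample_lik n p a e (v j) X) \<partial>?M) =
          ennreal ((1 / sqrt (1 - ?y)) ^ n)"
        using quarter[OF ij] by (intro sample_lik_product p a v ij e(1)) auto
      ultimately show ?thesis by (simp add: ennreal_leI exp_of_nat_mult)
    qed
    then have "(\<Sum>i\<in>I. \<Sum>j\<in>I. \<integral>\<^sup>+X. ennreal (sample_lik n p a e (v i) X) *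
        ennreal (sample_lik n p a e (v j) X) \<partial>?M) \<le>
        (\<Sum>i\<in>I. \<Sum>j\<in>I. ennreal (exp (real n * (e * (\<Sum>k<p. v i k * v j k))\<^sup>2)))"
      by (intro sum_mono) auto
    also have "\<dots> = ennreal (\<Sum>i\<in>I. \<Sum>j\<in>I. exp (real n * (e * (\<Sum>k<p. v i k * v j k))\<^sup>2))"
      by (simp add: sum_nonneg)
    also have "\<dots> \<le> ennreal (2 * (real (card I))\<^sup>2)" by (intro ennreal_leI corr)
    finally show "(\<Sum>i\<in>I. \<Sum>j\<in>I. \<integral>\<^sup>+X. ennreal (sample_lik n p a e (v i) X) *
        ennreal (sample_lik n p a e (v j) X) \<partial>?M) \<le> ennreal (2 * (real (card I))\<^sup>2)" .
  qed simp
  then consider "ennreal (1 / 8) \<le> emeasure ?M (error_event n p T (a \<cdot>\<^sub>m 1\<^sub>m p) r)"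
    | i where "i \<in> I" "ennreal (1 / 8) \<le> emeasure (PiM {..<n} (\<lambda>_. ?Alt i))
       (space ?M - error_event n p T (a \<cdot>\<^sub>m 1\<^sub>m p) r)"
    using density by auto
  then show ?thesis
  proof cases
    case 1
    have "?Null \<in> prob_distributions p"
      using prob_space_gaussian_scalar[OF p a] by (simp add: prob_distributions_def)
    then show ?thesis
      using contaminated_gaussian[OF \<epsilon>] 1 by (intro worst_case_prob_ge[OF F(1)]) auto
  next
    case 2
    have "space ?M - error_event n p T (a \<cdot>\<^sub>m 1\<^sub>m p) r \<subseteq> error_event n p T (spike p a (a * e) (v i)) r"
      unfolding space_M using a e by (intro error_event_spike_cover T v 2 r) auto
    then have "ennreal (1 / 8) \<le> emeasure (PiM {..<n} (\<lambda>_. ?Alt i)) (error_event n p T (spike p a (a * e) (v i)) r)"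
      using 2(2) by (elim order_trans) (intro emeasure_mono, auto simp: sets_M sets_error_event[OF T])
    moreover have "?Alt i \<in> prob_distributions p"
      using prob_P[OF 2(1)] by (simp add: prob_distributions_def)
    ultimately show ?thesis
      using contaminated_gaussian[OF \<epsilon>] by (intro worst_case_prob_ge[OF F(2)[OF 2(1)]]) auto
  qed
qed

text \<open>
  The likelihood ratio of the spike is at least \<open>1 / sqrt (1 + e)\<close>, its value at \<open>0\<close>, and this is at least
  \<open>1 - \<epsilon>\<close>. Hence subtracting \<open>1 - \<epsilon>\<close> times the null law from the spiked law leaves a positive measure
  of mass \<open>\<epsilon>\<close>, which serves as the contamination.
\<close>

lemma contaminated_scalar_eq_spike:
  assumes p: "1 \<le> p" and v: "unit_direction p v" and a: "0 < a"
    and \<epsilon>: "0 < \<epsilon>" "\<epsilon> \<le> 1" and e: "0 \<le> e" "e \<le> \<epsilon>"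
  obtains Q where "Q \<in> prob_distributions p"
    "contaminated p \<epsilon> (a \<cdot>\<^sub>m 1\<^sub>m p) Q = gaussian p (spike p a (a * e) v)"
proof -
  let ?Null = "gaussian p (a \<cdot>\<^sub>m 1\<^sub>m p)"
  let ?Alt = "gaussian p (spike p a (a * e) v)"
  let ?L = "spike_lik p a e v"
  interpret P0: prob_space ?Null by (rule prob_space_gaussian_scalar[OF p a])
  interpret P1: prob_space ?Alt by (rule prob_space_gaussian_spike[OF v a e(1)])
  have L: "1 - \<epsilon> \<le> ?L x" for x
  proof -
    have "((1 - \<epsilon>) * sqrt (1 + e))\<^sup>2 = (1 - \<epsilon>)\<^sup>2 * (1 + e)"
      using e by (simp add: power_mult_distrib)
    also have "\<dots> \<le> (1 - \<epsilon>)\<^sup>2 * (1 + \<epsilon>)" using e by (intro mult_left_mono) auto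
    also have "\<dots> = (1 - \<epsilon>) * (1 - \<epsilon>\<^sup>2)" by (simp add: power2_eq_square algebra_simps)
    also have "\<dots> \<le> 1 * 1" using \<epsilon> by (intro mult_mono) (auto simp: power_le_one)
    finally have "((1 - \<epsilon>) * sqrt (1 + e))\<^sup>2 \<le> 1\<^sup>2" by simp
    then have "(1 - \<epsilon>) * sqrt (1 + e) \<le> 1" by (rule power2_le_imp_le) simp
    then have "1 - \<epsilon> \<le> 1 / sqrt (1 + e)" using e by (simp add: le_divide_eq)
    also have "\<dots> \<le> ?L x"
      unfolding spike_lik_def using e a by (intro divide_right_mono) auto
    finally show ?thesis .
  qed
  \<comment> \<open>The normalised difference between the spiked law and \<open>1 - \<epsilon>\<close> times the null law.\<close>
  define Q where "Q = density ?Null (\<lambda>x. (?L x - (1 - \<epsilon>)) / \<epsilon>)"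
  have sets_Q: "sets Q = sets (R_space p)" by (simp add: Q_def)
  have split: "ennreal (1 - \<epsilon>) * emeasure ?Null A + ennreal \<epsilon> * emeasure Q A = emeasure ?Alt A"
    if A [measurable]: "A \<in> sets (R_space p)" for A
  proof -
    have "ennreal (1 - \<epsilon>) * emeasure ?Null A + ennreal \<epsilon> * emeasure Q A =
        (\<integral>\<^sup>+x. ennreal (1 - \<epsilon>) * indicator A x \<partial>?Null) +
        (\<integral>\<^sup>+x. ennreal \<epsilon> * (ennreal ((?L x - (1 - \<epsilon>)) / \<epsilon>) * indicator A x) \<partial>?Null)"
      by (simp add: Q_def emeasure_density nn_integral_cmult)
    also have "\<dots> = (\<integral>\<^sup>+x. ennreal (1 - \<epsilon>) * indicator A x +
        ennreal \<epsilon> * (ennreal ((?L x - (1 - \<epsilon>)) / \<epsilon>) * indicator A x) \<partial>?Null)"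
      by (rule nn_integral_add[symmetric]) measurable
    also have "\<dots> = (\<integral>\<^sup>+x. ennreal (?L x) * indicator A x \<partial>?Null)"
    proof (rule nn_integral_cong)
      fix x
      have "ennreal \<epsilon> * ennreal ((?L x - (1 - \<epsilon>)) / \<epsilon>) = ennreal (\<epsilon> * ((?L x - (1 - \<epsilon>)) / \<epsilon>))"
        using \<epsilon> L[of x] by (intro ennreal_mult[symmetric]) auto
      also have "\<epsilon> * ((?L x - (1 - \<epsilon>)) / \<epsilon>) = ?L x - (1 - \<epsilon>)" using \<epsilon> by simp
      finally have "ennreal (1 - \<epsilon>) + ennreal \<epsilon> * ennreal ((?L x - (1 - \<epsilon>)) / \<epsilon>) =
          ennreal (1 - \<epsilon>) + ennreal (?L x - (1 - \<epsilon>))" by simp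
      also have "\<dots> = ennreal (1 - \<epsilon> + (?L x - (1 - \<epsilon>)))"
        using \<epsilon> L[of x] by (intro ennreal_plus[symmetric]) auto
      finally have "ennreal (1 - \<epsilon>) + ennreal \<epsilon> * ennreal ((?L x - (1 - \<epsilon>)) / \<epsilon>) = ennreal (?L x)"
        by simp
      then show "ennreal (1 - \<epsilon>) * indicator A x +
          ennreal \<epsilon> * (ennreal ((?L x - (1 - \<epsilon>)) / \<epsilon>) * indicator A x) = ennreal (?L x) * indicator A x"
        by (cases "x \<in> A") simp_all
    qed
    also have "\<dots> = emeasure ?Alt A"
      unfolding gaussian_spike_eq_density[OF v p a e(1)] by (simp add: emeasure_density)
    finally show ?thesis .
  qed
  have "emeasure Q (space Q) = 1"
  proof -
    have "space Q = space (R_space p)" "space ?Null = space (R_space p)" "space ?Alt = space (R_space p)"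
      by (simp_all only: sets_eq_imp_space_eq[OF sets_Q] sets_eq_imp_space_eq[OF sets_gaussian])
    then have "ennreal (1 - \<epsilon>) + ennreal \<epsilon> * emeasure Q (space Q) = 1"
      using split[of "space (R_space p)"] P0.emeasure_space_1 P1.emeasure_space_1 by simp
    moreover have "ennreal (1 - \<epsilon>) + ennreal \<epsilon> * 1 = 1"
      using \<epsilon> by (simp flip: ennreal_plus)
    ultimately have "ennreal (1 - \<epsilon>) + ennreal \<epsilon> * emeasure Q (space Q) = ennreal (1 - \<epsilon>) + ennreal \<epsilon> * 1"
      by simp
    then have "ennreal \<epsilon> * emeasure Q (space Q) = ennreal \<epsilon> * 1"
      by (subst (asm) ennreal_add_left_cancel) auto
    then show ?thesis
      using \<epsilon> by (subst (asm) ennreal_mult_cancel_left) auto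
  qed
  then have "Q \<in> prob_distributions p"
    using sets_Q by (auto simp: prob_distributions_def intro: prob_spaceI)
  moreover have "contaminated p \<epsilon> (a \<cdot>\<^sub>m 1\<^sub>m p) Q = ?Alt"
    by (rule contaminated_eqI) (simp_all add: split)
  ultimately show ?thesis by (rule that)
qed

text \<open>
  The same law of the sample arises from the null matrix, contaminated suitably, and from the spike,
  contaminated by itself. The two error events cover the sample space, so one of them has probability at
  least \<open>1/2\<close>, hence at least \<open>1/8\<close>.
\<close>

lemma worst_case_prob_contamination:
  assumes p: "1 \<le> p" and v: "unit_direction p v" and T: "T \<in> estimators n p"
    and a: "0 < a" and \<epsilon>: "0 < \<epsilon>" "\<epsilon> \<le> 1" and e: "0 \<le> e" "e \<le> \<epsilon>" and r: "4 * r \<le> (a * e)\<^sup>2"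
    and F: "a \<cdot>\<^sub>m 1\<^sub>m p \<in> F" "spike p a (a * e) v \<in> F"
  shows "ennreal (1 / 8) \<le> worst_case_prob n p \<epsilon> F T r"
proof -
  let ?Alt = "gaussian p (spike p a (a * e) v)"
  let ?M = "PiM {..<n} (\<lambda>_. ?Alt)"
  let ?A = "error_event n p T (a \<cdot>\<^sub>m 1\<^sub>m p) r"
  let ?B = "error_event n p T (spike p a (a * e) v) r"
  obtain Q where Q: "Q \<in> prob_distributions p" "contaminated p \<epsilon> (a \<cdot>\<^sub>m 1\<^sub>m p) Q = ?Alt"
    by (rule contaminated_scalar_eq_spike[OF p v a \<epsilon> e])
  have P1: "prob_space ?Alt" by (rule prob_space_gaussian_spike[OF v a e(1)])
  interpret M: prob_space ?M by (intro prob_space_PiM P1)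
  have sets_M: "sets ?M = sets (PiM {..<n} (\<lambda>_. R_space p))" by (intro sets_PiM_cong) auto
  have space_M: "space ?M = space (PiM {..<n} (\<lambda>_. R_space p))"
    by (rule sets_eq_imp_space_eq[OF sets_M])
  have A: "?A \<in> sets ?M" and B: "?B \<in> sets ?M"
    by (simp_all add: sets_M sets_error_event[OF T])
  have "space ?M \<subseteq> ?A \<union> ?B"
    using error_event_spike_cover[OF T v _ r, of a] a e unfolding space_M by auto
  then have "emeasure ?M (space ?M) \<le> emeasure ?M (?A \<union> ?B)"
    using A B by (intro emeasure_mono) auto
  also have "\<dots> \<le> emeasure ?M ?A + emeasure ?M ?B" using A B by (rule emeasure_subadditive)
  finally have cover: "1 \<le> emeasure ?M ?A + emeasure ?M ?B" by (simp add: M.emeasure_space_1)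
  have "ennreal (1 / 8) \<le> emeasure ?M ?A \<or> ennreal (1 / 8) \<le> emeasure ?M ?B"
  proof (rule ccontr)
    assume "\<not> ?thesis"
    then have "emeasure ?M ?A + emeasure ?M ?B \<le> ennreal (1 / 8) + ennreal (1 / 8)"
      by (intro add_mono) auto
    also have "\<dots> = ennreal (1 / 4)" by (subst ennreal_plus[symmetric]) auto
    finally have "emeasure ?M ?A + emeasure ?M ?B \<le> ennreal (1 / 4)" .
    with cover have "ennreal 1 \<le> ennreal (1 / 4)" unfolding ennreal_1 by (rule order_trans)
    then show False by (subst (asm) ennreal_le_iff) auto
  qed
  then show ?thesis
  proof
    assume "ennreal (1 / 8) \<le> emeasure ?M ?A"
    then show ?thesis using Q by (intro worst_case_prob_ge[OF F(1)]) auto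
  next
    assume "ennreal (1 / 8) \<le> emeasure ?M ?B"
    moreover have "?Alt \<in> prob_distributions p" using P1 by (simp add: prob_distributions_def)
    ultimately show ?thesis
      using contaminated_gaussian[of \<epsilon>] \<epsilon> by (intro worst_case_prob_ge[OF F(2)]) auto
  qed
qed


section \<open>Two families of directions\<close>

definition cube_direction :: "nat \<Rightarrow> (nat \<Rightarrow> real) \<Rightarrow> nat \<Rightarrow> real" where
  "cube_direction m s i = (if i < m then s i / sqrt (real m) else 0)"

abbreviation sign_vectors :: "nat \<Rightarrow> (nat \<Rightarrow> real) set" where
  "sign_vectors m \<equiv> PiE {..<m} (\<lambda>_. {- 1, 1})"

lemma sign_vectors_cases: "s \<in> sign_vectors m \<Longrightarrow> i < m \<Longrightarrow> s i = 1 \<or> s i = - 1"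
  by (auto simp: PiE_iff)

lemma cube_direction_inner:
  assumes "m \<le> p"
  shows "(\<Sum>i<p. cube_direction m s i * cube_direction m t i) = (\<Sum>i<m. s i * t i) / real m"
proof -
  have "(\<Sum>i<p. cube_direction m s i * cube_direction m t i) = (\<Sum>i<m. s i * t i / real m)"
    using assms by (intro sum.mono_neutral_cong_right) (auto simp: cube_direction_def)
  then show ?thesis by (simp add: sum_divide_distrib)
qed

lemma unit_cube_direction:
  assumes "1 \<le> m" "m \<le> p" "s \<in> sign_vectors m"
  shows "unit_direction p (cube_direction m s)"
proof -
  have "s i * s i = 1" if "i < m" for i
    using sign_vectors_cases[OF assms(3) that] by auto
  then have "(\<Sum>i<m. s i * s i) = (\<Sum>i<m. 1)"
    by (intro sum.cong) auto
  then show ?thesis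
    using cube_direction_inner[OF assms(2), of s s] assms(1)
    by (simp add: unit_direction_def power2_eq_square)
qed

text \<open>
  Distinct axes contribute \<open>1\<close>. Each of the \<open>p\<close> diagonal terms contributes \<open>exp (n e\<^sup>2) \<le> p\<close>, so the
  diagonal contributes at most \<open>p\<^sup>2\<close> in total.
\<close>

lemma axis_family_correlation:
  assumes "1 \<le> p" "real n * e\<^sup>2 \<le> ln (real p)"
  shows "(\<Sum>i<p. \<Sum>j<p. exp (real n * (e * (\<Sum>k<p. axis_direction i k * axis_direction j k))\<^sup>2)) \<le>
    2 * (real p)\<^sup>2"
proof -
  have "exp (real n * e\<^sup>2) \<le> exp (ln (real p))" using assms(2) by simp
  also have "\<dots> = real p" using assms(1) by (intro exp_ln) simp
  finally have E: "exp (real n * e\<^sup>2) \<le> real p" .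
  have "(\<Sum>j<p. exp (real n * (e * (\<Sum>k<p. axis_direction i k * axis_direction j k))\<^sup>2)) \<le> 2 * real p"
    if i: "i < p" for i
  proof -
    have "(\<Sum>j<p. exp (real n * (e * (\<Sum>k<p. axis_direction i k * axis_direction j k))\<^sup>2)) \<le>
        (\<Sum>j<p. 1 + (if j = i then real p else 0))"
      unfolding sum_axis_direction[OF i] using E
      by (intro sum_mono) (auto simp: axis_direction_def)
    also have "\<dots> = 2 * real p" using i by (simp add: sum.distrib)
    finally show ?thesis .
  qed
  then have "(\<Sum>i<p. \<Sum>j<p. exp (real n * (e * (\<Sum>k<p. axis_direction i k * axis_direction j k))\<^sup>2)) \<le>
      (\<Sum>i<p. 2 * real p)"
    by (intro sum_mono) auto
  then show ?thesis by (simp add: power2_eq_square)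
qed

text \<open>
  Here \<open>n e\<^sup>2 = \<tau>\<^sup>2 m\<close>, so the exponential moment of the squared sum of signs is taken at \<open>\<tau>\<^sup>2 \<le> 1/4\<close>, where it
  is at most \<open>sqrt 2 \<le> 2\<close>.
\<close>

lemma cube_family_correlation:
  assumes n: "1 \<le> n" and m: "1 \<le> m" "m \<le> p" and \<tau>: "0 \<le> \<tau>" "\<tau> \<le> 1 / 2"
  defines "e \<equiv> \<tau> * sqrt (real m / real n)"
  shows "(\<Sum>s\<in>sign_vectors m. \<Sum>t\<in>sign_vectors m.
      exp (real n * (e * (\<Sum>k<p. cube_direction m s k * cube_direction m t k))\<^sup>2)) \<le>
    2 * (real (card (sign_vectors m)))\<^sup>2"
proof -
  define l where "l = \<tau>\<^sup>2 * real m"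
  have \<tau>2: "\<tau>\<^sup>2 \<le> 1 / 4" using power_mono[OF \<tau>(2,1), of 2] by (simp add: power2_eq_square)
  have ratio: "2 * l / real m = 2 * \<tau>\<^sup>2" using m by (simp add: l_def)
  have ne2: "real n * (e * x)\<^sup>2 = l * x\<^sup>2" for x
    using n by (simp add: e_def l_def power_mult_distrib)
  have "1 / 2 \<le> sqrt (1 - 2 * \<tau>\<^sup>2)"
    using \<tau>2 by (intro real_le_rsqrt) (simp add: power2_eq_square)
  moreover from this have "0 < sqrt (1 - 2 * \<tau>\<^sup>2)" by linarith
  ultimately have root: "1 / sqrt (1 - 2 * \<tau>\<^sup>2) \<le> 2" by (subst divide_le_eq) simp
  have card: "real (card (sign_vectors m)) = 2 ^ m" by (simp add: card_PiE)
  have "(\<Sum>t\<in>sign_vectors m. exp (real n * (e * (\<Sum>k<p. cube_direction m s k * cube_direction m t k))\<^sup>2)) \<le>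
      2 ^ m * 2" if s: "s \<in> sign_vectors m" for s
  proof -
    have "(\<Sum>t\<in>sign_vectors m. exp (real n * (e * (\<Sum>k<p. cube_direction m s k * cube_direction m t k))\<^sup>2)) \<le>
        2 ^ m * (1 / sqrt (1 - 2 * l / real m))"
      unfolding cube_direction_inner[OF m(2)] ne2
      using \<tau>2 sign_vectors_cases[OF s] by (intro sum_sign_exp_square_le) (auto simp: ratio l_def)
    also have "\<dots> \<le> 2 ^ m * 2" unfolding ratio using root by (intro mult_left_mono) auto
    finally show ?thesis .
  qed
  then have "(\<Sum>s\<in>sign_vectors m. \<Sum>t\<in>sign_vectors m.
      exp (real n * (e * (\<Sum>k<p. cube_direction m s k * cube_direction m t k))\<^sup>2)) \<le>
      (\<Sum>s\<in>sign_vectors m. 2 ^ m * 2)"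
    by (intro sum_mono) auto
  then show ?thesis by (simp add: card power2_eq_square)
qed

text \<open>
  Whichever of the three terms dominates the rate selects the family: signs for \<open>m / n\<close>, axes for
  \<open>ln p / n\<close>, and a single contaminated spike for \<open>\<epsilon>\<^sup>2\<close>. Spikes along the axes are available up to
  the relative size \<open>\<delta>\<close>, and \<open>\<tau>\<close> is the common factor in the sizes of the two families.
\<close>

lemma worst_case_prob_lower_bound:
  assumes n: "1 \<le> n" and p: "1 \<le> p" and m: "m \<le> p" and \<epsilon>: "\<epsilon> \<in> {0..1}"
    and T: "T \<in> estimators n p" and a: "0 < a"
    and \<delta>: "\<delta> \<le> 1 / 2" and \<tau>: "0 < \<tau>" "\<tau> \<le> \<delta>"
    and small: "\<tau>\<^sup>2 * (real m / real n) \<le> \<delta>\<^sup>2" "\<tau>\<^sup>2 * (ln (real p) / real n) \<le> \<delta>\<^sup>2"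
    and rate: "R \<le> 4 * max (real m / real n) (ln (real p) / real n)"
    and axis: "\<And>i e. i < p \<Longrightarrow> 0 \<le> e \<Longrightarrow> e \<le> \<delta> \<Longrightarrow> spike p a (a * e) (axis_direction i) \<in> F"
    and cube: "\<And>s. 1 \<le> m \<Longrightarrow> s \<in> sign_vectors m \<Longrightarrow>
      spike p a (a * (\<tau> * sqrt (real m / real n))) (cube_direction m s) \<in> F"
  shows "ennreal (1 / 8) \<le> worst_case_prob n p \<epsilon> F T ((a * \<tau>)\<^sup>2 / 16 * max R (\<epsilon>\<^sup>2))"
proof -
  have \<delta>0: "0 < \<delta>" and \<tau>_half: "\<tau> \<le> 1 / 2" using \<tau> \<delta> by auto
  have scalar: "a \<cdot>\<^sub>m 1\<^sub>m p \<in> F" using axis[of 0 0] p \<delta>0 by simp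
  have lnp: "0 \<le> ln (real p) / real n" using p by simp
  define r where "r = (a * \<tau>)\<^sup>2 / 16 * max R (\<epsilon>\<^sup>2)"
  have level: "4 * r \<le> (a * (\<tau> * sqrt x))\<^sup>2" if "0 \<le> x" "max R (\<epsilon>\<^sup>2) \<le> 4 * x" for x
  proof -
    have "4 * r = (a * \<tau>)\<^sup>2 / 4 * max R (\<epsilon>\<^sup>2)" by (simp add: r_def)
    also have "\<dots> \<le> (a * \<tau>)\<^sup>2 / 4 * (4 * x)" using that(2) by (rule mult_left_mono) simp
    also have "\<dots> = (a * (\<tau> * sqrt x))\<^sup>2" using that(1) by (simp add: power_mult_distrib)
    finally show ?thesis .
  qed
  have size: "\<tau> * sqrt x \<le> \<delta>" if "0 \<le> x" "\<tau>\<^sup>2 * x \<le> \<delta>\<^sup>2" for x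
    using that \<delta>0 by (intro power2_le_imp_le[of "\<tau> * sqrt x" \<delta>]) (auto simp: power_mult_distrib)
  \<comment> \<open>If \<open>\<epsilon> = 0\<close> then the right-hand side of \<open>rate\<close> is nonnegative and one of the first two cases applies.
    If \<open>m = 0\<close> then the first term of the rate vanishes and the axes take over.\<close>
  consider (signs) "1 \<le> m" "max R (\<epsilon>\<^sup>2) \<le> 4 * (real m / real n)"
    | (axes) "max R (\<epsilon>\<^sup>2) \<le> 4 * (ln (real p) / real n)"
    | (contamination) "max R (\<epsilon>\<^sup>2) = \<epsilon>\<^sup>2" "0 < \<epsilon>"
  proof (cases "max R (\<epsilon>\<^sup>2) \<le> 4 * max (real m / real n) (ln (real p) / real n)")
    case True
    show ?thesis
    proof (cases "m = 0 \<or> real m / real n \<le> ln (real p) / real n")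
      case True
      then have "max (real m / real n) (ln (real p) / real n) = ln (real p) / real n"
        using lnp by auto
      then show ?thesis using that(2) \<open>max R _ \<le> _\<close> by simp
    next
      case False
      then have "max (real m / real n) (ln (real p) / real n) = real m / real n" "1 \<le> m" by auto
      then show ?thesis using that(1) \<open>max R _ \<le> _\<close> by simp
    qed
  next
    case False
    then have "max R (\<epsilon>\<^sup>2) = \<epsilon>\<^sup>2" using rate by auto
    moreover have "\<epsilon> \<noteq> 0"
    proof
      assume "\<epsilon> = 0"
      then have "\<epsilon>\<^sup>2 \<le> 4 * max (real m / real n) (ln (real p) / real n)" using lnp by simp
      then show False using False rate by simp
    qed
    ultimately show ?thesis using that(3) \<epsilon> by auto
  qed
  then have "ennreal (1 / 8) \<le> worst_case_prob n p \<epsilon> F T r"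
  proof cases
    case signs
    define e where "e = \<tau> * sqrt (real m / real n)"
    have e: "0 \<le> e" "e \<le> 1 / 2"
      using \<tau> \<delta> size[OF _ small(1)] by (auto simp: e_def intro: order_trans)
    have "4 * r \<le> (a * e)\<^sup>2" unfolding e_def using signs by (intro level) auto
    moreover have "sign_vectors m \<noteq> {}" by (auto simp: PiE_eq_empty_iff)
    moreover have "finite (sign_vectors m)" by (intro finite_PiE) auto
    ultimately show ?thesis
      using signs m unit_cube_direction[of m p] cube_family_correlation[OF n signs(1) m _ \<tau>_half] \<tau> cube
      by (intro worst_case_prob_spike_family[OF p \<epsilon> T a e, where v = "cube_direction m" and I = "sign_vectors m"])
         (auto simp: e_def scalar)
  next
    case axes
    define e where "e = \<tau> * sqrt (ln (real p) / real n)"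
    have e: "0 \<le> e" "e \<le> \<delta>" using \<tau> lnp size[OF lnp small(2)] by (auto simp: e_def)
    then have "e \<le> 1 / 2" using \<delta> by simp
    have "real n * e\<^sup>2 = \<tau>\<^sup>2 * ln (real p)" using n lnp by (simp add: e_def power_mult_distrib)
    also have "\<dots> \<le> 1 * ln (real p)"
      using \<tau> \<tau>_half p by (intro mult_right_mono) (auto simp: power_le_one)
    finally have corr: "real n * e\<^sup>2 \<le> ln (real p)" by simp
    have "4 * r \<le> (a * e)\<^sup>2" unfolding e_def using axes lnp by (intro level) auto
    moreover have "{..<p} \<noteq> {}" using p by (auto simp: lessThan_empty_iff)
    ultimately show ?thesis
      using axis_family_correlation[OF p corr] unit_axis_direction e axis
      by (intro worst_case_prob_spike_family[OF p \<epsilon> T a e(1) \<open>e \<le> 1 / 2\<close>, where v = axis_direction and I = "{..<p}"])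
         (auto simp: scalar)
  next
    case contamination
    have e: "0 \<le> \<delta> * \<epsilon>" "\<delta> * \<epsilon> \<le> \<epsilon>" "\<delta> * \<epsilon> \<le> \<delta>"
      using \<delta> \<delta>0 \<epsilon> contamination(2) by (auto simp: mult_left_le_one_le mult_right_le_one_le)
    have "4 * r = (a * \<tau>)\<^sup>2 * \<epsilon>\<^sup>2 / 4" by (simp add: r_def contamination(1))
    also have "\<dots> \<le> (a * \<tau>)\<^sup>2 * \<epsilon>\<^sup>2" by simp
    also have "\<dots> \<le> (a * \<delta>)\<^sup>2 * \<epsilon>\<^sup>2"
      using \<tau> a by (intro mult_right_mono power_mono mult_left_mono) auto
    also have "\<dots> = (a * (\<delta> * \<epsilon>))\<^sup>2" by (simp add: power_mult_distrib)
    finally have "4 * r \<le> (a * (\<delta> * \<epsilon>))\<^sup>2" .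
    moreover have "unit_direction p (axis_direction 0)" using p by (intro unit_axis_direction) simp
    moreover have "spike p a (a * (\<delta> * \<epsilon>)) (axis_direction 0) \<in> F"
      using p e by (intro axis) auto
    ultimately show ?thesis
      using \<epsilon> by (intro worst_case_prob_contamination[OF p _ T a contamination(2) _ e(1,2) _ scalar]) auto
  qed
  then show ?thesis by (simp add: r_def)
qed


section \<open>Spikes in the classes of covariance matrices\<close>

lemma spike_in_F_class:
  assumes "unit_direction p v" "0 < a" "0 \<le> d" "a + d \<le> M"
  shows "spike p a d v \<in> F_class p M"
  using assms by (simp add: F_class_def psd_spike s_max_spike)

lemma spike_in_F_banded:
  assumes "0 \<le> a" "0 \<le> d" "\<And>i j. i < p \<Longrightarrow> j < p \<Longrightarrow> \<bar>int i - int j\<bar> > int k \<Longrightarrow> v i * v j = 0"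
  shows "spike p a d v \<in> F_banded p k"
  using assms by (auto simp: F_banded_def psd_spike)

lemma spike_in_F_bandable:
  assumes v: "unit_direction p v" and p: "1 \<le> p" and "0 < a" "0 \<le> d" "a + d \<le> M" "Mmin < a"
    and tail: "\<And>k j. 1 \<le> k \<Longrightarrow> j < p \<Longrightarrow>
      (\<Sum>i | i < p \<and> \<bar>int i - int j\<bar> > int k. \<bar>d * v i * v j\<bar>) \<le> M0 * real k powr - \<alpha>"
  shows "spike p a d v \<in> F_bandable p \<alpha> M M0 Mmin"
  unfolding F_bandable_def
proof (intro CollectI conjI allI impI)
  show "spike p a d v \<in> F_class p M" using assms by (simp add: spike_in_F_class)
next
  fix k :: nat assume k: "1 \<le> k"
  have "(\<Sum>i | i < p \<and> \<bar>int i - int j\<bar> > int k. \<bar>spike p a d v $$ (i, j)\<bar>) \<le> M0 * real k powr - \<alpha>"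
    if j: "j < p" for j
  proof -
    have "(\<Sum>i | i < p \<and> \<bar>int i - int j\<bar> > int k. \<bar>spike p a d v $$ (i, j)\<bar>) =
        (\<Sum>i | i < p \<and> \<bar>int i - int j\<bar> > int k. \<bar>d * v i * v j\<bar>)"
      using j by (intro sum.cong) auto
    then show ?thesis using tail[OF k j] by simp
  qed
  then show "(MAX j \<in> {..<p}. \<Sum>i | i < p \<and> \<bar>int i - int j\<bar> > int k. \<bar>spike p a d v $$ (i, j)\<bar>)
      \<le> M0 * real k powr - \<alpha>"
    using p by (subst Max_le_iff) (auto simp: lessThan_empty_iff)
next
  show "Mmin < s_min (spike p a d v)"
    using s_min_spike_ge[OF v \<open>0 < a\<close> \<open>0 \<le> d\<close>] \<open>Mmin < a\<close> by simp
qed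

lemma axis_direction_mult_eq_0: "i \<noteq> j \<Longrightarrow> axis_direction l i * axis_direction l j = 0"
  by (simp add: axis_direction_def)

lemma abs_cube_direction_mult_le:
  assumes "s \<in> sign_vectors m"
  shows "\<bar>cube_direction m s i * cube_direction m s j\<bar> \<le> (if i < m then 1 / real m else 0)"
  using sign_vectors_cases[OF assms, of i] sign_vectors_cases[OF assms, of j]
  by (auto simp: cube_direction_def abs_mult)

text \<open>
  Beyond distance \<open>k \<ge> m\<close> there are no entries. For smaller \<open>k\<close> a row has at most \<open>m\<close> entries of size
  \<open>d / m\<close>, and \<open>m powr - \<alpha> \<le> k powr - \<alpha>\<close>.
\<close>

lemma cube_direction_tail:
  assumes s: "s \<in> sign_vectors m" and m: "1 \<le> m" "m \<le> p" and k: "1 \<le> k" and j: "j < p"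
    and d: "0 \<le> d" "d \<le> M0 * real m powr - \<alpha>" and "0 < \<alpha>" "0 < M0"
  shows "(\<Sum>i | i < p \<and> \<bar>int i - int j\<bar> > int k. \<bar>d * cube_direction m s i * cube_direction m s j\<bar>)
    \<le> M0 * real k powr - \<alpha>"
proof (cases "m \<le> k")
  case True
  have "(\<Sum>i | i < p \<and> \<bar>int i - int j\<bar> > int k. \<bar>d * cube_direction m s i * cube_direction m s j\<bar>) = 0"
    using True by (intro sum.neutral) (auto simp: cube_direction_def)
  then show ?thesis using \<open>0 < M0\<close> by simp
next
  case False
  have "(\<Sum>i | i < p \<and> \<bar>int i - int j\<bar> > int k. \<bar>d * cube_direction m s i * cube_direction m s j\<bar>) \<le>
      (\<Sum>i<p. \<bar>d * cube_direction m s i * cube_direction m s j\<bar>)"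
    by (intro sum_mono2) auto
  also have "\<dots> \<le> (\<Sum>i<p. d * (if i < m then 1 / real m else 0))"
  proof (rule sum_mono)
    fix i
    have "\<bar>d * cube_direction m s i * cube_direction m s j\<bar> =
        d * \<bar>cube_direction m s i * cube_direction m s j\<bar>"
      using d(1) by (simp add: abs_mult)
    also have "\<dots> \<le> d * (if i < m then 1 / real m else 0)"
      using abs_cube_direction_mult_le[OF s] d(1) by (rule mult_left_mono)
    finally show "\<bar>d * cube_direction m s i * cube_direction m s j\<bar> \<le> d * (if i < m then 1 / real m else 0)" .
  qed
  also have "\<dots> = (\<Sum>i<m. d / real m)"
    using m(2) by (intro sum.mono_neutral_cong_right) auto
  also have "\<dots> = d" using m(1) by simp
  also have "\<dots> \<le> M0 * real m powr - \<alpha>" by (rule d(2))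
  also have "\<dots> \<le> M0 * real k powr - \<alpha>"
    using False k \<open>0 < \<alpha>\<close> \<open>0 < M0\<close> by (intro mult_left_mono powr_mono2') auto
  finally show ?thesis .
qed

text \<open>
  This is where the exponent \<open>1 / (2 \<alpha> + 1)\<close> comes from: \<open>m / n \<le> m powr (- 2 \<alpha>)\<close> means
  \<open>m powr (2 \<alpha> + 1) \<le> n\<close>.
\<close>

lemma sqrt_le_powr_decay:
  assumes n: "1 \<le> n" and m: "1 \<le> m" and \<alpha>: "0 < \<alpha>"
    and le: "real m \<le> real n powr (1 / (2 * \<alpha> + 1))"
  shows "sqrt (real m / real n) \<le> real m powr - \<alpha>"
proof -
  have "real m powr (2 * \<alpha> + 1) \<le> (real n powr (1 / (2 * \<alpha> + 1))) powr (2 * \<alpha> + 1)"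
    using le \<alpha> by (intro powr_mono2) auto
  also have "\<dots> = real n" using \<alpha> n by (simp add: powr_powr)
  finally have "real m / real n \<le> real m / real m powr (2 * \<alpha> + 1)"
    using m n by (intro divide_left_mono) auto
  also have "\<dots> = real m powr 1 / real m powr (2 * \<alpha> + 1)" using m by simp
  also have "\<dots> = real m powr (- \<alpha> + - \<alpha>)"
    unfolding powr_diff[symmetric] by simp
  also have "\<dots> = (real m powr - \<alpha>)\<^sup>2" by (simp only: powr_add power2_eq_square)
  finally show ?thesis by (intro real_le_lsqrt) auto
qed

theorem theorem3p5:
  fixes \<gamma> \<kappa> M M0 Mmin :: real
  assumes "\<gamma> > 0" and "\<kappa> > 0"
    and "M > 0" and "M0 > 0" and "0 < Mmin" and "Mmin < M"
  shows "\<exists>C>0. \<exists>c>0. \<forall>n p :: nat. n \<ge> 1 \<longrightarrow> p \<ge> 1 \<longrightarrow> real p \<le> exp (\<gamma> * real n) \<longrightarrow>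
    (\<forall>\<epsilon>\<in>{0..1::real}.
      (\<forall>k::nat. k \<le> p \<longrightarrow> real k \<le> \<kappa> * real n \<longrightarrow>
        (INF T \<in> estimators n p. SUP S \<in> F_banded p k \<inter> F_class p M. SUP Q \<in> prob_distributions p.
          emeasure (sample_law n p \<epsilon> S Q)
            {X \<in> space (sample_law n p \<epsilon> S Q).
              (op_norm (T X - S))\<^sup>2 \<ge> C * max ((real k + ln (real p)) / real n) (\<epsilon>\<^sup>2)})
        \<ge> ennreal c) \<and>
      (\<forall>\<alpha>>0.
        (INF T \<in> estimators n p. SUP S \<in> F_bandable p \<alpha> M M0 Mmin. SUP Q \<in> prob_distributions p.
          emeasure (sample_law n p \<epsilon> S Q)
            {X \<in> space (sample_law n p \<epsilon> S Q).
              (op_norm (T X - S))\<^sup>2 \<ge>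
                C * max (min (real n powr (- (2 * \<alpha> / (2 * \<alpha> + 1))) + ln (real p) / real n)
                             (real p / real n))
                        (\<epsilon>\<^sup>2)})
        \<ge> ennreal c))"
proof -
  \<comment> \<open>The midpoint leaves room on both sides: \<open>a > Mmin\<close> bounds the smallest singular value of a spike, and
    spikes of relative size at most \<open>\<delta>\<close> stay below \<open>M\<close>. Dividing by \<open>G\<close> absorbs the ratios \<open>k / n \<le> \<kappa>\<close>
    and \<open>ln p / n \<le> \<gamma>\<close>, and the bound \<open>a \<tau> \<le> M0\<close> is the decay condition for the sign family.\<close>
  define a where "a = (M + Mmin) / 2"
  define \<delta> where "\<delta> = (M - Mmin) / (2 * (M + Mmin))"
  define G where "G = 1 + \<gamma> + \<kappa>"
  define \<tau> where "\<tau> = min (\<delta> / G) (M0 / a)"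
  have a: "0 < a" "Mmin < a" using assms by (auto simp: a_def)
  have \<delta>: "0 < \<delta>" "\<delta> \<le> 1 / 2" using assms by (auto simp: \<delta>_def field_simps)
  have top: "a + a * e \<le> M" if "e \<le> \<delta>" for e
  proof -
    have "a * e \<le> a * \<delta>" using that a by simp
    also have "a * \<delta> = (M - Mmin) / 4" using assms by (simp add: a_def \<delta>_def field_simps)
    finally have "a + a * e \<le> a + (M - Mmin) / 4" by simp
    also have "\<dots> \<le> M" using assms by (simp add: a_def field_simps)
    finally show ?thesis .
  qed
  have G: "1 < G" "\<gamma> \<le> G" "\<kappa> \<le> G" using assms by (auto simp: G_def)
  have \<tau>: "0 < \<tau>" "a * \<tau> \<le> M0" "\<tau> \<le> \<delta>"
  proof -
    show "0 < \<tau>" using \<delta> G a assms by (simp add: \<tau>_def)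
    have "a * \<tau> \<le> a * (M0 / a)" using a by (intro mult_left_mono) (auto simp: \<tau>_def)
    then show "a * \<tau> \<le> M0" using a by simp
    have "\<tau> \<le> \<delta> / G" by (simp add: \<tau>_def)
    also have "\<dots> \<le> \<delta>" using \<delta> G by (simp add: divide_le_eq)
    finally show "\<tau> \<le> \<delta>" .
  qed
  have small: "\<tau>\<^sup>2 * x \<le> \<delta>\<^sup>2" if "x \<le> G" for x
  proof -
    have "\<tau>\<^sup>2 * x \<le> \<tau>\<^sup>2 * G" using that by (intro mult_left_mono) auto
    also have "\<dots> \<le> (\<delta> / G)\<^sup>2 * G"
      using \<tau>(1) G(1) by (intro mult_right_mono power_mono) (auto simp: \<tau>_def)
    also have "\<dots> = \<delta>\<^sup>2 / G" using G(1) by (simp add: power2_eq_square)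
    also have "\<dots> \<le> \<delta>\<^sup>2" using G(1) by (simp add: divide_le_eq mult_le_cancel_left1)
    finally show ?thesis .
  qed
  have log_le: "ln (real p) / real n \<le> G"
    if "1 \<le> n" "1 \<le> p" "real p \<le> exp (\<gamma> * real n)" for n p :: nat
  proof -
    have "ln (real p) \<le> ln (exp (\<gamma> * real n))" using that by (subst ln_le_cancel_iff) auto
    then have "ln (real p) / real n \<le> \<gamma>" using that by (simp add: divide_le_eq)
    then show ?thesis using G by simp
  qed
  have axis_F_class: "spike p a (a * e) (axis_direction i) \<in> F_class p M"
    if "i < p" "0 \<le> e" "e \<le> \<delta>" for p i e
    using that a top by (intro spike_in_F_class unit_axis_direction) auto
  have cube_size: "0 \<le> \<tau> * sqrt (real m / real n)" "\<tau> * sqrt (real m / real n) \<le> \<delta>"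
    if "real m / real n \<le> G" for m n :: nat
  proof -
    show "0 \<le> \<tau> * sqrt (real m / real n)" using \<tau> by simp
    have "(\<tau> * sqrt (real m / real n))\<^sup>2 \<le> \<delta>\<^sup>2"
      using small[OF that] by (simp add: power_mult_distrib)
    then show "\<tau> * sqrt (real m / real n) \<le> \<delta>" using less_imp_le[OF \<delta>(1)] by (rule power2_le_imp_le)
  qed
  have cube_F_class: "spike p a (a * (\<tau> * sqrt (real m / real n))) (cube_direction m s) \<in> F_class p M"
    if "1 \<le> m" "m \<le> p" "s \<in> sign_vectors m" "real m / real n \<le> G" for n p m s
    using that a top cube_size[of m n] by (intro spike_in_F_class unit_cube_direction) auto
  have banded: "ennreal (1 / 8) \<le> worst_case_prob n p \<epsilon> (F_banded p k \<inter> F_class p M) T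
      ((a * \<tau>)\<^sup>2 / 16 * max ((real k + ln (real p)) / real n) (\<epsilon>\<^sup>2))"
    if np: "1 \<le> n" "1 \<le> p" "real p \<le> exp (\<gamma> * real n)" and \<epsilon>: "\<epsilon> \<in> {0..1}"
      and k: "k \<le> p" "real k \<le> \<kappa> * real n" and T: "T \<in> estimators n p" for n p k \<epsilon> T
  proof -
    have kn: "real k / real n \<le> G"
    proof -
      have "real k / real n \<le> \<kappa>" using k(2) np(1) by (simp add: divide_le_eq)
      then show ?thesis using G(3) by simp
    qed
    show ?thesis
    proof (rule worst_case_prob_lower_bound[OF np(1,2) k(1) \<epsilon> T a(1) \<delta>(2) \<tau>(1,3) small[OF kn]
          small[OF log_le[OF np]]])
      have "0 \<le> real k / real n" by simp
      then show "(real k + ln (real p)) / real n \<le> 4 * max (real k / real n) (ln (real p) / real n)"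
        unfolding add_divide_distrib by linarith
    next
      fix i e assume "i < p" "0 \<le> e" "e \<le> \<delta>"
      then show "spike p a (a * e) (axis_direction i) \<in> F_banded p k \<inter> F_class p M"
        using a axis_F_class by (auto intro!: spike_in_F_banded axis_direction_mult_eq_0)
    next
      fix s assume "1 \<le> k" "s \<in> sign_vectors k"
      then show "spike p a (a * (\<tau> * sqrt (real k / real n))) (cube_direction k s) \<in>
          F_banded p k \<inter> F_class p M"
        using a cube_F_class k(1) kn cube_size[OF kn]
        by (auto intro!: spike_in_F_banded simp: cube_direction_def)
    qed
  qed
  have bandable: "ennreal (1 / 8) \<le> worst_case_prob n p \<epsilon> (F_bandable p \<alpha> M M0 Mmin) T
      ((a * \<tau>)\<^sup>2 / 16 * max (min (real n powr (- (2 * \<alpha> / (2 * \<alpha> + 1))) + ln (real p) / real n)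
        (real p / real n)) (\<epsilon>\<^sup>2))"
    if np: "1 \<le> n" "1 \<le> p" "real p \<le> exp (\<gamma> * real n)" and \<epsilon>: "\<epsilon> \<in> {0..1}"
      and \<alpha>: "0 < \<alpha>" and T: "T \<in> estimators n p" for n p \<alpha> \<epsilon> T
  proof -
    \<comment> \<open>The optimal bandwidth \<open>x\<close>. Rounding it down to an integer loses at most a factor of two, because \<open>x \<ge> 1\<close>.\<close>
    define x where "x = real n powr (1 / (2 * \<alpha> + 1))"
    define m where "m = min (nat \<lfloor>x\<rfloor>) p"
    have x: "1 \<le> x" "x \<le> real n"
    proof -
      show "1 \<le> x" unfolding x_def using np \<alpha> by (intro ge_one_powr_ge_zero) auto
      have "x \<le> real n powr 1" unfolding x_def using np \<alpha> by (intro powr_mono) auto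
      then show "x \<le> real n" using np by simp
    qed
    have floor: "real (nat \<lfloor>x\<rfloor>) \<le> x" "x \<le> 2 * real (nat \<lfloor>x\<rfloor>)" "1 \<le> nat \<lfloor>x\<rfloor>"
    proof -
      have "1 \<le> \<lfloor>x\<rfloor>" using x(1) by (simp add: le_floor_iff)
      then have "real (nat \<lfloor>x\<rfloor>) = real_of_int \<lfloor>x\<rfloor>" "1 \<le> real_of_int \<lfloor>x\<rfloor>" by simp_all
      moreover have "real_of_int \<lfloor>x\<rfloor> \<le> x" "x < real_of_int \<lfloor>x\<rfloor> + 1" by linarith+
      ultimately show "real (nat \<lfloor>x\<rfloor>) \<le> x" "x \<le> 2 * real (nat \<lfloor>x\<rfloor>)" by linarith+
      show "1 \<le> nat \<lfloor>x\<rfloor>" using \<open>1 \<le> \<lfloor>x\<rfloor>\<close> by linarith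
    qed
    have m: "1 \<le> m" "m \<le> p" "real m \<le> x"
      using floor np by (auto simp: m_def)
    have mn: "real m / real n \<le> G"
    proof -
      have "real m / real n \<le> 1" using m x np by (simp add: divide_le_eq)
      then show ?thesis using G(1) by simp
    qed
    have rate_x: "real n powr (- (2 * \<alpha> / (2 * \<alpha> + 1))) = x / real n"
    proof -
      have "- (2 * \<alpha> / (2 * \<alpha> + 1)) = 1 / (2 * \<alpha> + 1) - 1" using \<alpha> by (simp add: field_simps)
      then show ?thesis using np by (simp add: x_def powr_diff)
    qed
    have d: "a * (\<tau> * sqrt (real m / real n)) \<le> M0 * real m powr - \<alpha>"
    proof -
      have "a * (\<tau> * sqrt (real m / real n)) = (a * \<tau>) * sqrt (real m / real n)" by simp
      also have "\<dots> \<le> M0 * real m powr - \<alpha>"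
        using \<tau> a assms(4) sqrt_le_powr_decay[OF np(1) m(1) \<alpha>] m(3)
        by (intro mult_mono) (auto simp: x_def)
      finally show ?thesis .
    qed
    show ?thesis
    proof (rule worst_case_prob_lower_bound[OF np(1,2) m(2) \<epsilon> T a(1) \<delta>(2) \<tau>(1,3) small[OF mn]
          small[OF log_le[OF np]]])
      show "min (real n powr (- (2 * \<alpha> / (2 * \<alpha> + 1))) + ln (real p) / real n) (real p / real n) \<le>
          4 * max (real m / real n) (ln (real p) / real n)"
      proof (cases "real p \<le> x")
        case True
        then have "p \<le> nat \<lfloor>x\<rfloor>" by linarith
        then have "real m / real n = real p / real n" by (simp add: m_def)
        moreover have "0 \<le> real p / real n" by simp
        ultimately show ?thesis by linarith
      next
        case False
        then have "m = nat \<lfloor>x\<rfloor>" using floor(1) by (simp add: m_def)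
        then have "x / real n \<le> 2 * real m / real n" using floor(2) by (intro divide_right_mono) auto
        moreover have "0 \<le> real m / real n" by simp
        ultimately show ?thesis unfolding rate_x by linarith
      qed
    next
      fix i e assume ie: "i < p" "0 \<le> e" "e \<le> \<delta>"
      show "spike p a (a * e) (axis_direction i) \<in> F_bandable p \<alpha> M M0 Mmin"
      proof (rule spike_in_F_bandable)
        fix k j
        have "(\<Sum>l | l < p \<and> \<bar>int l - int j\<bar> > int k. \<bar>a * e * axis_direction i l * axis_direction i j\<bar>) = 0"
          by (intro sum.neutral) (auto simp: axis_direction_def)
        then show "(\<Sum>l | l < p \<and> \<bar>int l - int j\<bar> > int k. \<bar>a * e * axis_direction i l * axis_direction i j\<bar>)
            \<le> M0 * real k powr - \<alpha>"
          using assms(4) by simp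
      qed (use ie a top np unit_axis_direction in auto)
    next
      fix s assume "1 \<le> m" "s \<in> sign_vectors m"
      then show "spike p a (a * (\<tau> * sqrt (real m / real n))) (cube_direction m s) \<in>
          F_bandable p \<alpha> M M0 Mmin"
        using a top np m \<alpha> assms(4) d cube_size[OF mn]
        by (intro spike_in_F_bandable unit_cube_direction cube_direction_tail) auto
    qed
  qed
  have C: "0 < (a * \<tau>)\<^sup>2 / 16" and c: "(0::real) < 1 / 8" using a \<tau> by simp_all
  show ?thesis
  proof (rule exI[of _ "(a * \<tau>)\<^sup>2 / 16"], rule conjI[OF C], rule exI[of _ "1 / 8"], rule conjI[OF c],
      intro allI impI ballI conjI INF_greatest)
  qed (rule banded[unfolded worst_case_prob_def] bandable[unfolded worst_case_prob_def], assumption+)+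
qed

end
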